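(* Let $\alpha_0,\dots,\alpha_5,\eta$ be complex parameters with $\alpha_0+\alpha_1+\alpha_2+\alpha_3+\alpha_4+\alpha_5=1$, and let $H_{FS}$ be the polynomial in $(q_1,p_1,q_2,p_2)$ (with coefficients rational in $t$, $t\neq 0,1$) defined by $$t(t-1)H_{FS}=H_{VI}(q_1,p_1;\alpha_2,\alpha_0+\alpha_4,\alpha_3+\alpha_5-\eta,\eta\alpha_1)+H_{VI}(q_2,p_2;\alpha_0+\alpha_2,\alpha_4,\alpha_3+\alpha_1-\eta,\eta\alpha_5)+(q_1-t)(q_2-1)\{(q_1p_1+\alpha_1)p_2+p_1(q_2p_2+\alpha_5)\}.$$ Then the Hamiltonian system $$\frac{dq_1}{dt}=\frac{\partial H_{FS}}{\partial p_1},\quad \frac{dp_1}{dt}=-\frac{\partial H_{FS}}{\partial q_1},\quad \frac{dq_2}{dt}=\frac{\partial H_{FS}}{\partial p_2},\quad \frac{dp_2}{dt}=-\frac{\partial H_{FS}}{\partial q_2}$$ is transformed into a polynomial Hamiltonian system in the variables $(x_i,y_i,z_i,w_i)$ by each of the following birational symplectic transformations $r_i$ $(i=0,1,\dots,6)$: \begin{align*} r_0:(x_0,y_0,z_0,w_0)&=\left(-((q_1-q_2)p_1-\alpha_0)p_1,\tfrac{1}{p_1},q_2,p_2+p_1\right),\\ r_1:(x_1,y_1,z_1,w_1)&=\left(\tfrac{1}{q_1},-(q_1p_1+\alpha_1)q_1,q_2,p_2\right),\\ r_2:(x_2,y_2,z_2,w_2)&=\left(-((q_1-t)p_1-\alpha_2)p_1,\tfrac{1}{p_1},q_2,p_2\right),\\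 r_3:(x_3,y_3,z_3,w_3)&=\left(-(q_1p_1+q_2p_2-(\alpha_3-\eta))p_1,\tfrac{1}{p_1},q_2p_1,\tfrac{p_2}{p_1}\right),\\ r_4:(x_4,y_4,z_4,w_4)&=\left(q_1,p_1,-((q_2-1)p_2-\alpha_4)p_2,\tfrac{1}{p_2}\right),\\ r_5:(x_5,y_5,z_5,w_5)&=\left(q_1,p_1,\tfrac{1}{q_2},-(q_2p_2+\alpha_5)q_2\right),\\ r_6:(x_6,y_6,z_6,w_6)&=\left(-(XY+ZW-(\eta-\alpha_1-\alpha_5))Y,\tfrac{1}{Y},ZY,\tfrac{W}{Y}\right), \end{align*} where $(X,Y,Z,W)=\left(\tfrac{1}{q_1},-(q_1p_1+\alpha_1)q_1,\tfrac{1}{q_2},-(q_2p_2+\alpha_5)q_2\right)$.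
   Context: The symbol $H_{VI}$ denotes $$H_{VI}(q,p;a,b,c,d):=q(q-1)(q-t)p^2-\{(a-1)q(q-1)+bq(q-t)+c(q-1)(q-t)\}p+dq.$$ "Transformed into a polynomial Hamiltonian system by $r_i$" means that, in the coordinates $(x_i,y_i,z_i,w_i)$, the system is a Hamiltonian system (with canonical pairs $(x_i,y_i)$, $(z_i,w_i)$) whose Hamiltonian is a polynomial in $(x_i,y_i,z_i,w_i)$ with coefficients depending on $t$ ($t\ne 0,1$). For $i\neq 2$, where $r_i$ does not depend on $t$, this Hamiltonian is $H_{FS}$ expressed in the new variables; for the $t$-dependent transformation $r_2$ it is $H_{FS}-p_1$ expressed in the variables $(x_2,y_2,z_2,w_2)$. *)

theory Defs
  imports "HOL-Analysis.Analysis" "HOL-Computational_Algebra.Polynomial"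
begin

(* Points of the phase space, with canonical pairs (1st, 2nd) and (3rd, 4th): a point is
   (q1, p1, q2, p2) in the original coordinates and (x, y, z, w) in the new ones. *)
type_synonym phase = "complex \<times> complex \<times> complex \<times> complex"

section \<open>The Hamiltonian\<close>

definition H_VI ::
  "complex \<Rightarrow> complex \<Rightarrow> complex \<Rightarrow> complex \<Rightarrow> complex \<Rightarrow> complex \<Rightarrow> complex \<Rightarrow> complex" where
  "H_VI t q p a b c d =
     q * (q - 1) * (q - t) * p^2
     - ((a - 1) * q * (q - 1) + b * q * (q - t) + c * (q - 1) * (q - t)) * p + d * q"

definition H_FS :: "(nat \<Rightarrow> complex) \<Rightarrow> complex \<Rightarrow> complex \<Rightarrow> phase \<Rightarrow> complex" where
  "H_FS \<alpha> \<eta> t = (\<lambda>(q1, p1, q2, p2).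
     (H_VI t q1 p1 (\<alpha> 2) (\<alpha> 0 + \<alpha> 4) (\<alpha> 3 + \<alpha> 5 - \<eta>) (\<eta> * \<alpha> 1)
      + H_VI t q2 p2 (\<alpha> 0 + \<alpha> 2) (\<alpha> 4) (\<alpha> 3 + \<alpha> 1 - \<eta>) (\<eta> * \<alpha> 5)
      + (q1 - t) * (q2 - 1) * ((q1 * p1 + \<alpha> 1) * p2 + p1 * (q2 * p2 + \<alpha> 5)))
     / (t * (t - 1)))"

section \<open>The transformations\<close>

definition r0 :: "(nat \<Rightarrow> complex) \<Rightarrow> phase \<Rightarrow> phase" where
  "r0 \<alpha> = (\<lambda>(q1, p1, q2, p2).
     (- ((q1 - q2) * p1 - \<alpha> 0) * p1, 1 / p1, q2, p2 + p1))"

definition r1 :: "(nat \<Rightarrow> complex) \<Rightarrow> phase \<Rightarrow> phase" where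
  "r1 \<alpha> = (\<lambda>(q1, p1, q2, p2).
     (1 / q1, - (q1 * p1 + \<alpha> 1) * q1, q2, p2))"

definition r2 :: "(nat \<Rightarrow> complex) \<Rightarrow> complex \<Rightarrow> phase \<Rightarrow> phase" where
  "r2 \<alpha> t = (\<lambda>(q1, p1, q2, p2).
     (- ((q1 - t) * p1 - \<alpha> 2) * p1, 1 / p1, q2, p2))"

definition r3 :: "(nat \<Rightarrow> complex) \<Rightarrow> complex \<Rightarrow> phase \<Rightarrow> phase" where
  "r3 \<alpha> \<eta> = (\<lambda>(q1, p1, q2, p2).
     (- (q1 * p1 + q2 * p2 - (\<alpha> 3 - \<eta>)) * p1, 1 / p1, q2 * p1, p2 / p1))"

definition r4 :: "(nat \<Rightarrow> complex) \<Rightarrow> phase \<Rightarrow> phase" where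
  "r4 \<alpha> = (\<lambda>(q1, p1, q2, p2).
     (q1, p1, - ((q2 - 1) * p2 - \<alpha> 4) * p2, 1 / p2))"

definition r5 :: "(nat \<Rightarrow> complex) \<Rightarrow> phase \<Rightarrow> phase" where
  "r5 \<alpha> = (\<lambda>(q1, p1, q2, p2).
     (q1, p1, 1 / q2, - (q2 * p2 + \<alpha> 5) * q2))"

definition r6 :: "(nat \<Rightarrow> complex) \<Rightarrow> complex \<Rightarrow> phase \<Rightarrow> phase" where
  "r6 \<alpha> \<eta> = (\<lambda>(q1, p1, q2, p2).
     let X = 1 / q1; Y = - (q1 * p1 + \<alpha> 1) * q1;
         Z = 1 / q2; W = - (q2 * p2 + \<alpha> 5) * q2
     in (- (X * Y + Z * W - (\<eta> - \<alpha> 1 - \<alpha> 5)) * Y, 1 / Y, Z * Y, W / Y))"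

definition r_map :: "(nat \<Rightarrow> complex) \<Rightarrow> complex \<Rightarrow> nat \<Rightarrow> complex \<Rightarrow> phase \<Rightarrow> phase" where
  "r_map \<alpha> \<eta> i t = [r0 \<alpha>, r1 \<alpha>, r2 \<alpha> t, r3 \<alpha> \<eta>, r4 \<alpha>, r5 \<alpha>, r6 \<alpha> \<eta>] ! i"

(* Division is total in HOL, so the set where no denominator of the i-th map vanishes
   has to be recorded separately. *)
definition r_dom :: "(nat \<Rightarrow> complex) \<Rightarrow> nat \<Rightarrow> phase set" where
  "r_dom \<alpha> i =
     [{(q1, p1, q2, p2). p1 \<noteq> 0},
      {(q1, p1, q2, p2). q1 \<noteq> 0},
      {(q1, p1, q2, p2). p1 \<noteq> 0},
      {(q1, p1, q2, p2). p1 \<noteq> 0},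
      {(q1, p1, q2, p2). p2 \<noteq> 0},
      {(q1, p1, q2, p2). q2 \<noteq> 0},
      {(q1, p1, q2, p2). q1 \<noteq> 0 \<and> q2 \<noteq> 0 \<and> - (q1 * p1 + \<alpha> 1) * q1 \<noteq> 0}] ! i"

section \<open>Birational and symplectic maps\<close>

(* Polynomials in four variables are iterated univariate ones: the innermost variable is x,
   the outermost one is w. *)
definition poly4 :: "complex poly poly poly poly \<Rightarrow> phase \<Rightarrow> complex" where
  "poly4 P = (\<lambda>(x, y, z, w).
     poly (poly (poly (poly P [:[:[:w:]:]:]) [:[:z:]:]) [:y:]) x)"

definition rational_on :: "phase set \<Rightarrow> (phase \<Rightarrow> complex) \<Rightarrow> bool" where
  "rational_on D f \<longleftrightarrow>
     (\<exists>P Q. \<forall>v\<in>D. poly4 Q v \<noteq> 0 \<and> f v = poly4 P v / poly4 Q v)"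

definition rational_map_on :: "phase set \<Rightarrow> (phase \<Rightarrow> phase) \<Rightarrow> bool" where
  "rational_map_on D F \<longleftrightarrow>
     rational_on D (\<lambda>v. fst (F v)) \<and>
     rational_on D (\<lambda>v. fst (snd (F v))) \<and>
     rational_on D (\<lambda>v. fst (snd (snd (F v)))) \<and>
     rational_on D (\<lambda>v. snd (snd (snd (F v))))"

definition principal_open :: "phase set \<Rightarrow> bool" where
  "principal_open D \<longleftrightarrow> (\<exists>g. g \<noteq> 0 \<and> D = {v. poly4 g v \<noteq> 0})"

(* F is birational, with domain of definition D: it is rational on the nonempty Zariski open
   set D and has a rational inverse on a nonempty Zariski open set E. *)
definition birational_on :: "phase set \<Rightarrow> (phase \<Rightarrow> phase) \<Rightarrow> bool" where
  "birational_on D F \<longleftrightarrow>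
     principal_open D \<and> rational_map_on D F \<and>
     (\<exists>E G. principal_open E \<and> rational_map_on E G \<and>
        (\<forall>v\<in>D. F v \<in> E \<and> G (F v) = v) \<and> (\<forall>u\<in>E. G u \<in> D \<and> F (G u) = u))"

(* The form dq1 \<and> dp1 + dq2 \<and> dp2. *)
definition sympl :: "phase \<Rightarrow> phase \<Rightarrow> complex" where
  "sympl = (\<lambda>(a1, b1, a2, b2) (c1, d1, c2, d2).
     (a1 * d1 - b1 * c1) + (a2 * d2 - b2 * c2))"

definition symplectic_on :: "phase set \<Rightarrow> (phase \<Rightarrow> phase) \<Rightarrow> bool" where
  "symplectic_on D F \<longleftrightarrow>
     (\<forall>v\<in>D. \<exists>F'. (F has_derivative F') (at v) \<and>
        (\<forall>a b. sympl (F' a) (F' b) = sympl a b))"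

section \<open>Hamiltonian systems\<close>

(* Polynomials in (x, y, z, w) whose coefficients are rational in t with poles at most at
   t = 0 and t = 1; the innermost variable of P is t.  Finitely many such coefficients always
   have a common denominator of the form (t (t - 1))^m. *)
definition polynomial_hamiltonian :: "(complex \<Rightarrow> phase \<Rightarrow> complex) \<Rightarrow> bool" where
  "polynomial_hamiltonian K \<longleftrightarrow>
     (\<exists>(P :: complex poly poly poly poly poly) m. \<forall>t. t \<noteq> 0 \<longrightarrow> t \<noteq> 1 \<longrightarrow>
        (\<forall>x y z w. K t (x, y, z, w) =
           poly (poly (poly (poly (poly P [:[:[:[:w:]:]:]:]) [:[:[:z:]:]:]) [:[:y:]:]) [:x:]) t
           / (t * (t - 1)) ^ m))"

definition solves_hamiltonian_system ::
  "complex set \<Rightarrow> (complex \<Rightarrow> phase \<Rightarrow> complex) \<Rightarrow> (complex \<Rightarrow> phase) \<Rightarrow> bool" where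
  "solves_hamiltonian_system U H \<gamma> \<longleftrightarrow>
     (\<forall>t\<in>U. \<forall>q1 p1 q2 p2. \<gamma> t = (q1, p1, q2, p2) \<longrightarrow>
        ((\<lambda>s. fst (\<gamma> s)) has_field_derivative
           deriv (\<lambda>p. H t (q1, p, q2, p2)) p1) (at t) \<and>
        ((\<lambda>s. fst (snd (\<gamma> s))) has_field_derivative
           - deriv (\<lambda>q. H t (q, p1, q2, p2)) q1) (at t) \<and>
        ((\<lambda>s. fst (snd (snd (\<gamma> s)))) has_field_derivative
           deriv (\<lambda>p. H t (q1, p1, q2, p)) p2) (at t) \<and>
        ((\<lambda>s. snd (snd (snd (\<gamma> s)))) has_field_derivative
           - deriv (\<lambda>q. H t (q1, p1, q, p2)) q2) (at t))"

(* The t-dependent change of coordinates R t, defined on D, turns the system with Hamiltonian H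
   into the one with Hamiltonian K: a curve in D solves the former iff its image solves the
   latter. *)
definition transforms_system ::
  "phase set \<Rightarrow> (complex \<Rightarrow> phase \<Rightarrow> phase) \<Rightarrow>
   (complex \<Rightarrow> phase \<Rightarrow> complex) \<Rightarrow> (complex \<Rightarrow> phase \<Rightarrow> complex) \<Rightarrow> bool" where
  "transforms_system D R H K \<longleftrightarrow>
     (\<forall>U \<gamma>. open U \<longrightarrow> U \<subseteq> - {0, 1} \<longrightarrow> (\<forall>t\<in>U. \<gamma> t \<in> D) \<longrightarrow>
        (solves_hamiltonian_system U H \<gamma> \<longleftrightarrow>
         solves_hamiltonian_system U K (\<lambda>t. R t (\<gamma> t))))"

end

(* In each chart the poles of the old Hamiltonian cancel, leaving an explicit polynomial.
   It remains to transport solutions.  If F is symplectic with F'(v) complex linear and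
   K o F = H - S, then differentiating and using the nondegeneracy of the symplectic form gives
   X_K = dF/dt + F' X_H as soon as omega(dF/dt, F' b) = -dS(b) for all b; this accounts for the
   correction -p1 in the chart r_2.  The converse needs a curve to be differentiable whenever its
   image is, which follows from the rational inverse. *)

theory Submission
  imports Defs
begin

section \<open>Polynomial and rational functions on phase space\<close>

text \<open>Why the poles cancel: in the charts that invert a momentum, the singular part of
  \<open>t * (t - 1) * H_FS\<close> is that momentum times a factor which the new coordinates turn
  into a regular multiple of \<open>- x * y\<close> (or \<open>- z * w\<close>), and
  \<open>x * y / y = x\<close>. This dictates the shifts \<open>\<alpha> 0\<close>,
  \<open>\<alpha> 2\<close>, \<open>\<alpha> 3 - \<eta>\<close>, \<open>\<alpha> 4\<close> in the
  maps. In the charts at infinite \<open>q1\<close> or \<open>q2\<close>, the leading coefficient is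
  quadratic in \<open>q * p\<close>, and the normalisation of the sum of the \<alpha> splits it into
  linear factors, one of which is absorbed by the new momentum. A technical obstacle is that
  \<open>has_derivative\<close> on \<open>phase\<close> only provides real linear maps, while the
  equations of motion use complex partial derivatives. Complex linearity is therefore carried along
  explicitly, through \<open>has_gradient\<close> and \<open>cscale\<close>. The class
  \<open>regular\<close> is the common source of rationality at a fixed time, of complex gradients,
  and of differentiability along curves with explicit time dependence.\<close>

definition poly_fun :: "(phase \<Rightarrow> complex) \<Rightarrow> bool" where
  "poly_fun f \<longleftrightarrow> (\<exists>P. f = poly4 P)"

lemma poly_fun_const: "poly_fun (\<lambda>v. c)"
  unfolding poly_fun_def by (rule exI[of _ "[:[:[:[:c:]:]:]:]"]) (auto simp: poly4_def)

lemma poly_fun_coords: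
  "poly_fun (\<lambda>v. fst v)"
  "poly_fun (\<lambda>v. fst (snd v))"
  "poly_fun (\<lambda>v. fst (snd (snd v)))"
  "poly_fun (\<lambda>v. snd (snd (snd v)))"
  unfolding poly_fun_def
  by (rule exI[of _ "[:[:[:[:0, 1:]:]:]:]"] exI[of _ "[:[:[:0, 1:]:]:]"]
        exI[of _ "[:[:0, 1:]:]"] exI[of _ "[:0, 1:]"], force simp: poly4_def)+

lemma poly_fun_add: "poly_fun f \<Longrightarrow> poly_fun g \<Longrightarrow> poly_fun (\<lambda>v. f v + g v)"
  unfolding poly_fun_def
proof (elim exE)
  fix P Q assume "f = poly4 P" "g = poly4 Q"
  then show "\<exists>R. (\<lambda>v. f v + g v) = poly4 R"
    by (intro exI[of _ "P + Q"]) (auto simp: poly4_def)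
qed

lemma poly_fun_mult: "poly_fun f \<Longrightarrow> poly_fun g \<Longrightarrow> poly_fun (\<lambda>v. f v * g v)"
  unfolding poly_fun_def
proof (elim exE)
  fix P Q assume "f = poly4 P" "g = poly4 Q"
  then show "\<exists>R. (\<lambda>v. f v * g v) = poly4 R"
    by (intro exI[of _ "P * Q"]) (auto simp: poly4_def)
qed

lemma poly_fun_diff: "poly_fun f \<Longrightarrow> poly_fun g \<Longrightarrow> poly_fun (\<lambda>v. f v - g v)"
  using poly_fun_add[OF _ poly_fun_mult[OF poly_fun_const[of "-1"]], of f g] by simp

lemmas poly_fun_intros =
  poly_fun_const poly_fun_coords poly_fun_add poly_fun_mult poly_fun_diff

lemma rational_onI:
  assumes "poly_fun p" "poly_fun q" "\<And>v. v \<in> D \<Longrightarrow> q v \<noteq> 0 \<and> f v = p v / q v"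
  shows "rational_on D f"
  using assms unfolding poly_fun_def rational_on_def by blast

lemma rational_onE:
  assumes "rational_on D f"
  obtains p q where "poly_fun p" "poly_fun q" "\<And>v. v \<in> D \<Longrightarrow> q v \<noteq> 0 \<and> f v = p v / q v"
  using assms unfolding poly_fun_def rational_on_def by blast

text \<open>A single point where \<open>g\<close> does not vanish certifies that the polynomial
  behind it is not the zero polynomial.\<close>

lemma principal_openI:
  assumes "poly_fun g" "g v\<^sub>0 \<noteq> 0" "D = {v. g v \<noteq> 0}"
  shows "principal_open D"
proof -
  obtain P where P: "g = poly4 P"
    using assms(1) by (auto simp: poly_fun_def)
  have "poly4 0 v\<^sub>0 = 0"
    by (simp add: poly4_def split_def)
  with assms(2) P have "P \<noteq> 0"
    by auto
  with P assms(3) show ?thesis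
    unfolding principal_open_def by blast
qed

text \<open>The admissible times are \<open>t \<noteq> 0, 1\<close>; denominators may vanish at the others.\<close>

inductive regular :: "phase set \<Rightarrow> (complex \<Rightarrow> phase \<Rightarrow> complex) \<Rightarrow> bool" for D where
  const: "regular D (\<lambda>t v. c)"
| time: "regular D (\<lambda>t v. t)"
| coord1: "regular D (\<lambda>t v. fst v)"
| coord2: "regular D (\<lambda>t v. fst (snd v))"
| coord3: "regular D (\<lambda>t v. fst (snd (snd v)))"
| coord4: "regular D (\<lambda>t v. snd (snd (snd v)))"
| add: "regular D f \<Longrightarrow> regular D g \<Longrightarrow> regular D (\<lambda>t v. f t v + g t v)"
| mult: "regular D f \<Longrightarrow> regular D g \<Longrightarrow> regular D (\<lambda>t v. f t v * g t v)"
| divide: "regular D f \<Longrightarrow> regular D g \<Longrightarrow>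
    (\<And>t v. t \<noteq> 0 \<Longrightarrow> t \<noteq> 1 \<Longrightarrow> v \<in> D \<Longrightarrow> g t v \<noteq> 0) \<Longrightarrow> regular D (\<lambda>t v. f t v / g t v)"

lemma regular_uminus: "regular D f \<Longrightarrow> regular D (\<lambda>t v. - f t v)"
  using regular.mult[OF regular.const[of D "-1"], of f] by simp

lemma regular_diff: "regular D f \<Longrightarrow> regular D g \<Longrightarrow> regular D (\<lambda>t v. f t v - g t v)"
  using regular.add[OF _ regular_uminus, of D f g] by simp

lemma regular_power: "regular D f \<Longrightarrow> regular D (\<lambda>t v. f t v ^ n)"
  by (induction n) (auto intro: regular.intros)

lemmas regular_intros = regular.intros regular_uminus regular_diff regular_power

lemma rational_on_regular:
  assumes "regular D f" "t \<noteq> 0" "t \<noteq> 1"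
  shows "rational_on D (f t)"
  using assms
proof (induction rule: regular.induct)
  case (add f g)
  obtain p q p' q' where
    "poly_fun p" "poly_fun q" "\<And>v. v \<in> D \<Longrightarrow> q v \<noteq> 0 \<and> f t v = p v / q v"
    "poly_fun p'" "poly_fun q'" "\<And>v. v \<in> D \<Longrightarrow> q' v \<noteq> 0 \<and> g t v = p' v / q' v"
    using add by (metis rational_onE)
  then show ?case
    by (intro rational_onI[of "\<lambda>v. p v * q' v + p' v * q v" "\<lambda>v. q v * q' v"])
       (auto intro: poly_fun_intros simp: add_frac_eq)
next
  case (mult f g)
  obtain p q p' q' where
    "poly_fun p" "poly_fun q" "\<And>v. v \<in> D \<Longrightarrow> q v \<noteq> 0 \<and> f t v = p v / q v"
    "poly_fun p'" "poly_fun q'" "\<And>v. v \<in> D \<Longrightarrow> q' v \<noteq> 0 \<and> g t v = p' v / q' v"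
    using mult by (metis rational_onE)
  then show ?case
    by (intro rational_onI[of "\<lambda>v. p v * p' v" "\<lambda>v. q v * q' v"])
       (auto intro: poly_fun_intros)
next
  case (divide f g)
  obtain p q p' q' where pq:
    "poly_fun p" "poly_fun q" "\<And>v. v \<in> D \<Longrightarrow> q v \<noteq> 0 \<and> f t v = p v / q v"
    "poly_fun p'" "poly_fun q'" "\<And>v. v \<in> D \<Longrightarrow> q' v \<noteq> 0 \<and> g t v = p' v / q' v"
    using divide by (metis rational_onE)
  have "p' v \<noteq> 0" if "v \<in> D" for v
    using pq(6)[OF that] divide.hyps(3)[OF divide.prems that] by auto
  with pq show ?case
    by (intro rational_onI[of "\<lambda>v. p v * q' v" "\<lambda>v. q v * p' v"])
       (auto intro: poly_fun_intros)
qed (rule rational_onI[where q = "\<lambda>v. 1"], rule poly_fun_intros, rule poly_fun_intros, simp)+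

text \<open>Writing the derivative through four complex coefficients forces it to be complex linear,
  which \<open>has_derivative\<close> alone does not.\<close>

definition has_gradient :: "(phase \<Rightarrow> complex) \<Rightarrow> phase \<Rightarrow> phase \<Rightarrow> bool" where
  "has_gradient f = (\<lambda>(g1, g2, g3, g4) v.
     (f has_derivative (\<lambda>(a, b, c, d). g1 * a + g2 * b + g3 * c + g4 * d)) (at v))"

lemma regular_has_gradient:
  assumes "regular D f" "t \<noteq> 0" "t \<noteq> 1" "v \<in> D"
  shows "\<exists>g. has_gradient (f t) g v"
  using assms
proof (induction rule: regular.induct)
  case (const c)
  show ?case
    by (rule exI[of _ "(0, 0, 0, 0)"]) (simp add: has_gradient_def split_def)
next
  case time
  show ?case
    by (rule exI[of _ "(0, 0, 0, 0)"]) (simp add: has_gradient_def split_def)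
next
  case coord1
  show ?case
    by (rule exI[of _ "(1, 0, 0, 0)"])
       (auto intro!: derivative_eq_intros simp: has_gradient_def split_def)
next
  case coord2
  show ?case
    by (rule exI[of _ "(0, 1, 0, 0)"])
       (auto intro!: derivative_eq_intros simp: has_gradient_def split_def)
next
  case coord3
  show ?case
    by (rule exI[of _ "(0, 0, 1, 0)"])
       (auto intro!: derivative_eq_intros simp: has_gradient_def split_def)
next
  case coord4
  show ?case
    by (rule exI[of _ "(0, 0, 0, 1)"])
       (auto intro!: derivative_eq_intros simp: has_gradient_def split_def)
next
  case (add f g)
  then obtain a b c d a' b' c' d' where
    "has_gradient (f t) (a, b, c, d) v" "has_gradient (g t) (a', b', c', d') v"
    by (metis prod_cases4)
  then show ?case
    by (intro exI[of _ "(a + a', b + b', c + c', d + d')"])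
       (auto intro!: derivative_eq_intros simp: has_gradient_def split_def algebra_simps)
next
  case (mult f g)
  then obtain a b c d a' b' c' d' where
    "has_gradient (f t) (a, b, c, d) v" "has_gradient (g t) (a', b', c', d') v"
    by (metis prod_cases4)
  then show ?case
    by (intro exI[of _ "(f t v * a' + g t v * a, f t v * b' + g t v * b,
                         f t v * c' + g t v * c, f t v * d' + g t v * d)"])
       (auto intro!: derivative_eq_intros simp: has_gradient_def split_def algebra_simps)
next
  case (divide f g)
  then obtain a b c d a' b' c' d' where
    *: "has_gradient (f t) (a, b, c, d) v" "has_gradient (g t) (a', b', c', d') v"
    by (metis prod_cases4)
  have "g t v \<noteq> 0"
    using divide by blast
  with * show ?case
    by (intro exI[of _ "((a * g t v - f t v * a') / (g t v * g t v), (b * g t v - f t v * b') / (g t v * g t v),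
                         (c * g t v - f t v * c') / (g t v * g t v), (d * g t v - f t v * d') / (g t v * g t v))"])
       (auto intro!: derivative_eq_intros simp: has_gradient_def split_def field_simps)
qed

text \<open>Applied to the components of a rational inverse \<open>G\<close> and to the image curve,
  this recovers the differentiability of the original curve.\<close>

lemma regular_along_curve:
  assumes "regular D f" "t \<noteq> 0" "t \<noteq> 1" "\<gamma> t \<in> D"
    and "(\<lambda>s. fst (\<gamma> s)) field_differentiable at t"
      "(\<lambda>s. fst (snd (\<gamma> s))) field_differentiable at t"
      "(\<lambda>s. fst (snd (snd (\<gamma> s)))) field_differentiable at t"
      "(\<lambda>s. snd (snd (snd (\<gamma> s)))) field_differentiable at t"
  shows "(\<lambda>s. f s (\<gamma> s)) field_differentiable at t"
  using assms
proof (induction rule: regular.induct)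
  case (divide f g)
  then show ?case
    by (intro field_differentiable_divide) blast+
qed (auto intro: field_differentiable_add field_differentiable_mult)

definition regular_map :: "phase set \<Rightarrow> (complex \<Rightarrow> phase \<Rightarrow> phase) \<Rightarrow> bool" where
  "regular_map D F \<longleftrightarrow>
     regular D (\<lambda>t v. fst (F t v)) \<and>
     regular D (\<lambda>t v. fst (snd (F t v))) \<and>
     regular D (\<lambda>t v. fst (snd (snd (F t v)))) \<and>
     regular D (\<lambda>t v. snd (snd (snd (F t v))))"

lemma rational_map_on_regular:
  assumes "regular_map D F" "t \<noteq> 0" "t \<noteq> 1"
  shows "rational_map_on D (F t)"
  using assms rational_on_regular unfolding regular_map_def rational_map_on_def by blast

section \<open>Polynomial Hamiltonians\<close>

lemma polynomial_hamiltonian_const: "polynomial_hamiltonian (\<lambda>t v. c)"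
  unfolding polynomial_hamiltonian_def
  by (rule exI[of _ "[:[:[:[:[:c:]:]:]:]:]"], rule exI[of _ 0]) simp

lemma polynomial_hamiltonian_variables:
  "polynomial_hamiltonian (\<lambda>t v. t)"
  "polynomial_hamiltonian (\<lambda>t v. fst v)"
  "polynomial_hamiltonian (\<lambda>t v. fst (snd v))"
  "polynomial_hamiltonian (\<lambda>t v. fst (snd (snd v)))"
  "polynomial_hamiltonian (\<lambda>t v. snd (snd (snd v)))"
  unfolding polynomial_hamiltonian_def
  by (rule exI[of _ "[:[:[:[:[:0, 1:]:]:]:]:]"] exI[of _ "[:[:[:[:0, 1:]:]:]:]"]
        exI[of _ "[:[:[:0, 1:]:]:]"] exI[of _ "[:[:0, 1:]:]"] exI[of _ "[:0, 1:]"],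
      rule exI[of _ 0], force)+

lemma polynomial_hamiltonian_add:
  assumes "polynomial_hamiltonian f" "polynomial_hamiltonian g"
  shows "polynomial_hamiltonian (\<lambda>t v. f t v + g t v)"
proof -
  let ?ev = "\<lambda>P t x y z w. poly (poly (poly (poly (poly P [:[:[:[:w:]:]:]:]) [:[:[:z:]:]:]) [:[:y:]:]) [:x:]) t"
  \<comment> \<open>The polynomial \<open>t^2 - t\<close>, constant in the phase variables; its
    powers bring both fractions to the denominator \<open>(t * (t - 1)) ^ (m + n)\<close>.\<close>
  let ?d = "[:[:[:[:[:0, -1, 1:]:]:]:]:] :: complex poly poly poly poly poly"
  obtain P m Q n where P: "\<And>t x y z w. t \<noteq> 0 \<Longrightarrow> t \<noteq> 1 \<Longrightarrow> f t (x, y, z, w) = ?ev P t x y z w / (t * (t - 1)) ^ m"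
    and Q: "\<And>t x y z w. t \<noteq> 0 \<Longrightarrow> t \<noteq> 1 \<Longrightarrow> g t (x, y, z, w) = ?ev Q t x y z w / (t * (t - 1)) ^ n"
    using assms unfolding polynomial_hamiltonian_def by metis
  have d: "?ev (?d ^ k) t x y z w = (t * (t - 1)) ^ k" for k and t x y z w :: complex
    by (simp add: algebra_simps)
  have ev: "?ev (P * ?d ^ n + Q * ?d ^ m) t x y z w =
      ?ev P t x y z w * (t * (t - 1)) ^ n + ?ev Q t x y z w * (t * (t - 1)) ^ m" for t x y z w
    by (simp only: poly_add poly_mult d)
  have "f t (x, y, z, w) + g t (x, y, z, w) =
      ?ev (P * ?d ^ n + Q * ?d ^ m) t x y z w / (t * (t - 1)) ^ (m + n)"
    if "t \<noteq> 0" "t \<noteq> 1" for t x y z w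
    using that unfolding ev by (simp add: P Q power_add add_frac_eq)
  then show ?thesis
    unfolding polynomial_hamiltonian_def by blast
qed

lemma polynomial_hamiltonian_mult:
  assumes "polynomial_hamiltonian f" "polynomial_hamiltonian g"
  shows "polynomial_hamiltonian (\<lambda>t v. f t v * g t v)"
proof -
  let ?ev = "\<lambda>P t x y z w. poly (poly (poly (poly (poly P [:[:[:[:w:]:]:]:]) [:[:[:z:]:]:]) [:[:y:]:]) [:x:]) t"
  obtain P m Q n where P: "\<And>t x y z w. t \<noteq> 0 \<Longrightarrow> t \<noteq> 1 \<Longrightarrow> f t (x, y, z, w) = ?ev P t x y z w / (t * (t - 1)) ^ m"
    and Q: "\<And>t x y z w. t \<noteq> 0 \<Longrightarrow> t \<noteq> 1 \<Longrightarrow> g t (x, y, z, w) = ?ev Q t x y z w / (t * (t - 1)) ^ n"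
    using assms unfolding polynomial_hamiltonian_def by metis
  have "f t (x, y, z, w) * g t (x, y, z, w) = ?ev (P * Q) t x y z w / (t * (t - 1)) ^ (m + n)"
    if "t \<noteq> 0" "t \<noteq> 1" for t x y z w
    using that by (simp add: P Q power_add)
  then show ?thesis
    unfolding polynomial_hamiltonian_def by blast
qed

text \<open>The only division among the closure rules, so a derivation by them certifies that no
  other denominator occurs.\<close>

lemma polynomial_hamiltonian_divide:
  assumes "polynomial_hamiltonian f"
  shows "polynomial_hamiltonian (\<lambda>t v. f t v / (t * (t - 1)))"
proof -
  have "polynomial_hamiltonian (\<lambda>t v. 1 / (t * (t - 1)))"
    unfolding polynomial_hamiltonian_def
    by (rule exI[of _ "[:[:[:[:[:1:]:]:]:]:]"], rule exI[of _ 1]) simp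
  from polynomial_hamiltonian_mult[OF assms this] show ?thesis
    by simp
qed

lemma polynomial_hamiltonian_uminus:
  "polynomial_hamiltonian f \<Longrightarrow> polynomial_hamiltonian (\<lambda>t v. - f t v)"
  using polynomial_hamiltonian_mult[OF polynomial_hamiltonian_const[of "-1"], of f] by simp

lemma polynomial_hamiltonian_diff:
  "polynomial_hamiltonian f \<Longrightarrow> polynomial_hamiltonian g \<Longrightarrow>
   polynomial_hamiltonian (\<lambda>t v. f t v - g t v)"
  using polynomial_hamiltonian_add[OF _ polynomial_hamiltonian_uminus, of f g] by simp

lemma polynomial_hamiltonian_power:
  "polynomial_hamiltonian f \<Longrightarrow> polynomial_hamiltonian (\<lambda>t v. f t v ^ n)"
  by (induction n) (auto intro: polynomial_hamiltonian_const polynomial_hamiltonian_mult)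

lemmas polynomial_hamiltonian_intros =
  polynomial_hamiltonian_const polynomial_hamiltonian_variables polynomial_hamiltonian_add
  polynomial_hamiltonian_mult polynomial_hamiltonian_divide polynomial_hamiltonian_uminus
  polynomial_hamiltonian_diff polynomial_hamiltonian_power

section \<open>Transport of Hamiltonian systems\<close>

text \<open>Complex scalar multiplication, since the product type carries only a real vector space
  structure. The scalar stands on the right to match the shape \<open>a * h\<close> of a field
  derivative.\<close>

definition cscale :: "complex \<Rightarrow> phase \<Rightarrow> phase" where
  "cscale h = (\<lambda>(a, b, c, d). (a * h, b * h, c * h, d * h))"

definition ham_vec :: "(complex \<Rightarrow> phase \<Rightarrow> complex) \<Rightarrow> complex \<Rightarrow> phase \<Rightarrow> phase" where
  "ham_vec H t = (\<lambda>(q1, p1, q2, p2).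
     (deriv (\<lambda>p. H t (q1, p, q2, p2)) p1, - deriv (\<lambda>q. H t (q, p1, q2, p2)) q1,
      deriv (\<lambda>p. H t (q1, p1, q2, p)) p2, - deriv (\<lambda>q. H t (q1, p1, q, p2)) q2))"

lemma cscale_1 [simp]: "cscale 1 v = v"
  by (simp add: cscale_def split_def)

lemma cscale_0 [simp]: "cscale h 0 = 0"
  by (simp add: cscale_def zero_prod_def)

lemma cscale_add: "cscale h (u + v) = cscale h u + cscale h v"
  by (cases u rule: prod_cases4; cases v rule: prod_cases4) (simp add: cscale_def algebra_simps)

lemma sympl_add_left: "sympl (u + v) b = sympl u b + sympl v b"
  by (cases u rule: prod_cases4; cases v rule: prod_cases4; cases b rule: prod_cases4)
     (simp add: sympl_def algebra_simps)

lemma sympl_diff_left: "sympl (u - v) b = sympl u b - sympl v b"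
  by (cases u rule: prod_cases4; cases v rule: prod_cases4; cases b rule: prod_cases4)
     (simp add: sympl_def algebra_simps)

lemma sympl_nondegenerate:
  assumes "\<And>b. sympl u b = 0"
  shows "u = 0"
  using assms[of "(1, 0, 0, 0)"] assms[of "(0, 1, 0, 0)"] assms[of "(0, 0, 1, 0)"]
    assms[of "(0, 0, 0, 1)"]
  by (cases u rule: prod_cases4) (simp add: sympl_def zero_prod_def)

lemma phase_has_derivative_iff:
  "(\<gamma> has_derivative (\<lambda>h. cscale h (a, b, c, d))) (at t) \<longleftrightarrow>
     ((\<lambda>s. fst (\<gamma> s)) has_field_derivative a) (at t) \<and>
     ((\<lambda>s. fst (snd (\<gamma> s))) has_field_derivative b) (at t) \<and>
     ((\<lambda>s. fst (snd (snd (\<gamma> s)))) has_field_derivative c) (at t) \<and>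
     ((\<lambda>s. snd (snd (snd (\<gamma> s)))) has_field_derivative d) (at t)"
  (is "?L \<longleftrightarrow> ?R")
proof
  assume ?L
  from has_derivative_fst[OF this] has_derivative_fst[OF has_derivative_snd[OF this]]
    has_derivative_fst[OF has_derivative_snd[OF has_derivative_snd[OF this]]]
    has_derivative_snd[OF has_derivative_snd[OF has_derivative_snd[OF this]]]
  show ?R
    unfolding has_field_derivative_def cscale_def by (simp add: split_def)
next
  assume R: ?R
  have "((\<lambda>s. (fst (\<gamma> s), fst (snd (\<gamma> s)), fst (snd (snd (\<gamma> s))), snd (snd (snd (\<gamma> s)))))
     has_derivative (\<lambda>h. (a * h, b * h, c * h, d * h))) (at t)"
    using R unfolding has_field_derivative_def by (intro has_derivative_Pair) auto
  then show ?L
    by (simp add: cscale_def)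
qed

lemma solves_hamiltonian_system_iff:
  "solves_hamiltonian_system U H \<gamma> \<longleftrightarrow>
     (\<forall>t\<in>U. (\<gamma> has_derivative (\<lambda>h. cscale h (ham_vec H t (\<gamma> t)))) (at t))"
  unfolding solves_hamiltonian_system_def
proof (rule ball_cong[OF refl])
  fix t
  obtain q1 p1 q2 p2 where v: "\<gamma> t = (q1, p1, q2, p2)"
    by (rule prod_cases4)
  show "(\<forall>q1 p1 q2 p2. \<gamma> t = (q1, p1, q2, p2) \<longrightarrow>
        ((\<lambda>s. fst (\<gamma> s)) has_field_derivative
           deriv (\<lambda>p. H t (q1, p, q2, p2)) p1) (at t) \<and>
        ((\<lambda>s. fst (snd (\<gamma> s))) has_field_derivative
           - deriv (\<lambda>q. H t (q, p1, q2, p2)) q1) (at t) \<and>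
        ((\<lambda>s. fst (snd (snd (\<gamma> s)))) has_field_derivative
           deriv (\<lambda>p. H t (q1, p1, q2, p)) p2) (at t) \<and>
        ((\<lambda>s. snd (snd (snd (\<gamma> s)))) has_field_derivative
           - deriv (\<lambda>q. H t (q1, p1, q, p2)) q2) (at t)) \<longleftrightarrow>
      (\<gamma> has_derivative (\<lambda>h. cscale h (ham_vec H t (\<gamma> t)))) (at t)"
    unfolding v ham_vec_def prod.case phase_has_derivative_iff by simp
qed

text \<open>This is dH = omega(X_H, .). Restricting the total derivative to the four coordinate
  lines identifies the gradient entries with the \<open>deriv\<close> terms of the vector
  field.\<close>

lemma ham_vec_derivative:
  assumes "has_gradient (H t) g v"
  shows "(H t has_derivative sympl (ham_vec H t v)) (at v)"
proof -
  obtain q1 p1 q2 p2 where v: "v = (q1, p1, q2, p2)"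
    by (rule prod_cases4)
  obtain g1 g2 g3 g4 where g: "g = (g1, g2, g3, g4)"
    by (rule prod_cases4)
  let ?L = "\<lambda>(a, b, c, d). g1 * a + g2 * b + g3 * c + g4 * d"
  have L: "(H t has_derivative ?L) (at (q1, p1, q2, p2))"
    using assms unfolding has_gradient_def v g by simp
  have "((\<lambda>q. H t (q, p1, q2, p2)) has_derivative (\<lambda>h. ?L (h, 0, 0, 0))) (at q1)"
    by (rule has_derivative_compose[of "\<lambda>q. (q, p1, q2, p2)", OF _ L])
       (auto intro!: derivative_eq_intros simp: zero_prod_def)
  moreover have "((\<lambda>p. H t (q1, p, q2, p2)) has_derivative (\<lambda>h. ?L (0, h, 0, 0))) (at p1)"
    by (rule has_derivative_compose[of "\<lambda>p. (q1, p, q2, p2)", OF _ L])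
       (auto intro!: derivative_eq_intros simp: zero_prod_def)
  moreover have "((\<lambda>q. H t (q1, p1, q, p2)) has_derivative (\<lambda>h. ?L (0, 0, h, 0))) (at q2)"
    by (rule has_derivative_compose[of "\<lambda>q. (q1, p1, q, p2)", OF _ L])
       (auto intro!: derivative_eq_intros simp: zero_prod_def)
  moreover have "((\<lambda>p. H t (q1, p1, q2, p)) has_derivative (\<lambda>h. ?L (0, 0, 0, h))) (at p2)"
    by (rule has_derivative_compose[of "\<lambda>p. (q1, p1, q2, p)", OF _ L])
       (auto intro!: derivative_eq_intros simp: zero_prod_def)
  ultimately have "deriv (\<lambda>q. H t (q, p1, q2, p2)) q1 = g1"
    "deriv (\<lambda>p. H t (q1, p, q2, p2)) p1 = g2"
    "deriv (\<lambda>q. H t (q1, p1, q, p2)) q2 = g3"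
    "deriv (\<lambda>p. H t (q1, p1, q2, p)) p2 = g4"
    by (auto intro!: DERIV_imp_deriv simp: has_field_derivative_def)
  then have "sympl (ham_vec H t v) = ?L"
    by (auto simp: sympl_def ham_vec_def v fun_eq_iff algebra_simps)
  with L v show ?thesis
    by simp
qed

text \<open>A canonical transformation depending on time: \<open>A\<close> is its time derivative, and
  \<open>S\<close> is the correction it causes in the Hamiltonian.\<close>

definition canonical_at ::
  "(complex \<Rightarrow> phase \<Rightarrow> phase) \<Rightarrow> (phase \<Rightarrow> complex) \<Rightarrow> complex \<Rightarrow> phase \<Rightarrow> bool" where
  "canonical_at F S t v \<longleftrightarrow> (\<exists>A F' S'.
     ((\<lambda>(s, u). F s u) has_derivative (\<lambda>(h, b). cscale h A + F' b)) (at (t, v)) \<and>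
     (\<forall>c b. F' (cscale c b) = cscale c (F' b)) \<and>
     (\<forall>a b. sympl (F' a) (F' b) = sympl a b) \<and>
     (S has_derivative S') (at v) \<and> (\<forall>b. sympl A (F' b) = - S' b))"

lemma has_derivative_fixed_time:
  assumes "((\<lambda>(s, u). F s u) has_derivative (\<lambda>(h, b). cscale h A + F' b)) (at (t, v))"
  shows "(F t has_derivative F') (at v)"
proof -
  have "((\<lambda>u. (t, u)) has_derivative (\<lambda>b. (0, b))) (at v)"
    by (auto intro!: derivative_eq_intros)
  from has_derivative_compose[OF this assms] show ?thesis
    by (simp add: cscale_def split_def zero_prod_def[symmetric])
qed

lemma symplectic_on_canonical:
  assumes "\<And>v. v \<in> D \<Longrightarrow> canonical_at F S t v"
  shows "symplectic_on D (F t)"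
  unfolding symplectic_on_def
proof
  fix v assume "v \<in> D"
  then obtain A F' where
    "((\<lambda>(s, u). F s u) has_derivative (\<lambda>(h, b). cscale h A + F' b)) (at (t, v))"
    "\<forall>a b. sympl (F' a) (F' b) = sympl a b"
    using assms unfolding canonical_at_def by meson
  then show "\<exists>F'. (F t has_derivative F') (at v) \<and> (\<forall>a b. sympl (F' a) (F' b) = sympl a b)"
    using has_derivative_fixed_time by blast
qed

text \<open>A kernel vector pairs to zero with everything, so nondegeneracy kills it; finite
  dimension then gives surjectivity. Surjectivity serves to identify the new vector field,
  injectivity to pull a solution back.\<close>

lemma symplectic_bij:
  assumes "linear F'" "\<And>a b. sympl (F' a) (F' b) = sympl a b"
  shows "inj F'" "surj F'"
proof -
  have "b = 0" if "F' b = 0" for b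
  proof (rule sympl_nondegenerate)
    fix a
    show "sympl b a = 0"
      using assms(2)[of b a] that by (simp add: sympl_def split_def)
  qed
  then show "inj F'"
    using assms(1) by (simp add: linear_injective_0)
  then show "surj F'"
    using assms(1) linear_injective_imp_surjective by blast
qed

lemma transforms_systemI:
  assumes D: "open D" and H: "regular UNIV H" and K: "regular UNIV K" and G: "regular_map E G"
    and FE: "\<And>t v. v \<in> D \<Longrightarrow> F t v \<in> E" and GF: "\<And>t v. v \<in> D \<Longrightarrow> G t (F t v) = v"
    and can: "\<And>t v. v \<in> D \<Longrightarrow> canonical_at F S t v"
    and KF: "\<And>t v. t \<noteq> 0 \<Longrightarrow> t \<noteq> 1 \<Longrightarrow> v \<in> D \<Longrightarrow> K t (F t v) = H t v - S v"
  shows "transforms_system D F H K"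
  unfolding transforms_system_def solves_hamiltonian_system_iff
proof (intro allI impI ball_cong refl)
  fix U \<gamma> and t :: complex
  assume U: "open U" "U \<subseteq> - {0, 1}" and \<gamma>D: "\<forall>t\<in>U. \<gamma> t \<in> D" and tU: "t \<in> U"
  have t: "t \<noteq> 0" "t \<noteq> 1"
    using U tU by auto
  define v where "v = \<gamma> t"
  define XH where "XH = ham_vec H t v"
  define XK where "XK = ham_vec K t (F t v)"
  have vD: "v \<in> D"
    using \<gamma>D tU by (simp add: v_def)
  obtain A F' S' where
    F': "((\<lambda>(s, u). F s u) has_derivative (\<lambda>(h, b). cscale h A + F' b)) (at (t, v))"
    and F'_scale: "\<And>c b. F' (cscale c b) = cscale c (F' b)"
    and F'_sympl: "\<And>a b. sympl (F' a) (F' b) = sympl a b"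
    and S': "(S has_derivative S') (at v)" and A: "\<And>b. sympl A (F' b) = - S' b"
    using can[OF vD, of t] unfolding canonical_at_def by metis
  have Ft: "(F t has_derivative F') (at v)"
    by (rule has_derivative_fixed_time[OF F'])
  note bij = symplectic_bij[OF has_derivative_linear[OF Ft] F'_sympl]
  have field: "XK = A + F' XH"
  proof -
    have "(H t has_derivative sympl XH) (at v)"
      using regular_has_gradient[OF H t] ham_vec_derivative unfolding XH_def by blast
    then have "((\<lambda>u. H t u - S u) has_derivative (\<lambda>b. sympl XH b - S' b)) (at v)"
      using S' by (rule has_derivative_diff)
    \<comment> \<open>The two functions are known to agree only on \<open>D\<close>; openness of
      \<open>D\<close> lets the derivative pass from one to the other.\<close>
    then have "((\<lambda>u. K t (F t u)) has_derivative (\<lambda>b. sympl XH b - S' b)) (at v)"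
      by (rule has_derivative_transform_within_open[OF _ D vD]) (simp add: KF t)
    moreover have "(K t has_derivative sympl XK) (at (F t v))"
      using regular_has_gradient[OF K t] ham_vec_derivative unfolding XK_def by blast
    then have "((\<lambda>u. K t (F t u)) has_derivative (\<lambda>b. sympl XK (F' b))) (at v)"
      by (rule has_derivative_compose[OF Ft])
    ultimately have "sympl XK (F' b) = sympl XH b - S' b" for b
      by (metis has_derivative_unique)
    then have "sympl (XK - (A + F' XH)) (F' b) = 0" for b
      by (simp add: sympl_diff_left sympl_add_left A F'_sympl)
    \<comment> \<open>Every vector has the form \<open>F' b\<close>, so the difference pairs to zero
      with all of them.\<close>
    then have "XK - (A + F' XH) = 0"
      using bij(2) by (metis sympl_nondegenerate surjD)
    then show ?thesis
      by simp
  qed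
  have push: "((\<lambda>s. F s (\<gamma> s)) has_derivative (\<lambda>h. cscale h (A + F' X))) (at t)"
    if "(\<gamma> has_derivative (\<lambda>h. cscale h X)) (at t)" for X
  proof -
    have "((\<lambda>s. (s, \<gamma> s)) has_derivative (\<lambda>h. (h, cscale h X))) (at t)"
      using that by (auto intro!: derivative_eq_intros)
    from has_derivative_compose[OF this F'[unfolded v_def]] show ?thesis
      by (simp add: F'_scale cscale_add)
  qed
  show "(\<gamma> has_derivative (\<lambda>h. cscale h (ham_vec H t (\<gamma> t)))) (at t) \<longleftrightarrow>
    ((\<lambda>t. F t (\<gamma> t)) has_derivative (\<lambda>h. cscale h (ham_vec K t (F t (\<gamma> t))))) (at t)"
    unfolding v_def[symmetric] XH_def[symmetric] XK_def[symmetric]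
  proof
    assume "(\<gamma> has_derivative (\<lambda>h. cscale h XH)) (at t)"
    from push[OF this] show "((\<lambda>t. F t (\<gamma> t)) has_derivative (\<lambda>h. cscale h XK)) (at t)"
      unfolding field .
  next
    assume \<delta>: "((\<lambda>t. F t (\<gamma> t)) has_derivative (\<lambda>h. cscale h XK)) (at t)"
    \<comment> \<open>Only the image curve is known to be differentiable. On the open set
      \<open>U\<close> the original curve equals \<open>G s (F s (\<gamma> s))\<close>, which is
      regular along the image curve.\<close>
    obtain X where X: "(\<gamma> has_derivative (\<lambda>h. cscale h X)) (at t)"
    proof -
      obtain a b c d where "XK = (a, b, c, d)"
        by (rule prod_cases4)
      with \<delta> have "((\<lambda>t. F t (\<gamma> t)) has_derivative (\<lambda>h. cscale h (a, b, c, d))) (at t)"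
        by simp
      then have fd: "(\<lambda>s. fst (F s (\<gamma> s))) field_differentiable at t"
        "(\<lambda>s. fst (snd (F s (\<gamma> s)))) field_differentiable at t"
        "(\<lambda>s. fst (snd (snd (F s (\<gamma> s))))) field_differentiable at t"
        "(\<lambda>s. snd (snd (snd (F s (\<gamma> s))))) field_differentiable at t"
        unfolding phase_has_derivative_iff field_differentiable_def by blast+
      have E: "F t (\<gamma> t) \<in> E"
        using FE vD by (simp add: v_def)
      note along = regular_along_curve[where \<gamma> = "\<lambda>s. F s (\<gamma> s)", OF _ t E fd]
      have comps: "regular E (\<lambda>t v. fst (G t v))" "regular E (\<lambda>t v. fst (snd (G t v)))"
        "regular E (\<lambda>t v. fst (snd (snd (G t v))))" "regular E (\<lambda>t v. snd (snd (snd (G t v))))"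
        using G unfolding regular_map_def by blast+
      have "(\<lambda>s. fst (G s (F s (\<gamma> s)))) field_differentiable at t"
        "(\<lambda>s. fst (snd (G s (F s (\<gamma> s))))) field_differentiable at t"
        "(\<lambda>s. fst (snd (snd (G s (F s (\<gamma> s)))))) field_differentiable at t"
        "(\<lambda>s. snd (snd (snd (G s (F s (\<gamma> s)))))) field_differentiable at t"
        by (rule along[OF comps(1)] along[OF comps(2)] along[OF comps(3)] along[OF comps(4)])+
      then obtain a b c d where
        "((\<lambda>s. G s (F s (\<gamma> s))) has_derivative (\<lambda>h. cscale h (a, b, c, d))) (at t)"
        unfolding field_differentiable_def phase_has_derivative_iff by blast
      then obtain X where X: "((\<lambda>s. G s (F s (\<gamma> s))) has_derivative (\<lambda>h. cscale h X)) (at t)"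
        by blast
      have "(\<gamma> has_derivative (\<lambda>h. cscale h X)) (at t)"
        by (rule has_derivative_transform_within_open[OF X U(1) tU]) (use \<gamma>D GF in auto)
      then show ?thesis
        by (rule that)
    qed
    \<comment> \<open>Both maps are derivatives of the image curve at \<open>t\<close>; evaluating
      them at \<open>h = 1\<close> and cancelling the injective \<open>F'\<close> identifies
      \<open>X\<close>.\<close>
    have "(\<lambda>h. cscale h (A + F' X)) = (\<lambda>h. cscale h XK)"
      by (rule has_derivative_unique[OF push[OF X] \<delta>])
    then have "A + F' X = A + F' XH"
      unfolding field by (metis cscale_1)
    then have "X = XH"
      using bij(1) by (simp add: inj_eq)
    with X show "(\<gamma> has_derivative (\<lambda>h. cscale h XH)) (at t)"
      by simp
  qed
qed

text \<open>The time-independent counterpart of \<open>canonical_at\<close>; being closed under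
  composition, it lets \<open>r6\<close> be treated as a chain of simpler charts.\<close>

definition canonical_map_at :: "(phase \<Rightarrow> phase) \<Rightarrow> phase \<Rightarrow> bool" where
  "canonical_map_at f v \<longleftrightarrow> (\<exists>F'. (f has_derivative F') (at v) \<and>
     (\<forall>c b. F' (cscale c b) = cscale c (F' b)) \<and>
     (\<forall>a b. sympl (F' a) (F' b) = sympl a b))"

lemma canonical_map_at_compose:
  assumes "canonical_map_at f v" "canonical_map_at g (f v)"
  shows "canonical_map_at (\<lambda>u. g (f u)) v"
proof -
  obtain F' G' where
    "(f has_derivative F') (at v)" "\<And>c b. F' (cscale c b) = cscale c (F' b)"
    "\<And>a b. sympl (F' a) (F' b) = sympl a b"
    "(g has_derivative G') (at (f v))" "\<And>c b. G' (cscale c b) = cscale c (G' b)"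
    "\<And>a b. sympl (G' a) (G' b) = sympl a b"
    using assms unfolding canonical_map_at_def by metis
  then show ?thesis
    unfolding canonical_map_at_def
    by (intro exI[of _ "\<lambda>b. G' (F' b)"]) (auto intro: has_derivative_compose)
qed

lemma canonical_at_autonomous:
  assumes "canonical_map_at f v"
  shows "canonical_at (\<lambda>t. f) (\<lambda>v. 0) t v"
proof -
  obtain F' where F': "(f has_derivative F') (at v)"
    "\<forall>c b. F' (cscale c b) = cscale c (F' b)" "\<forall>a b. sympl (F' a) (F' b) = sympl a b"
    using assms unfolding canonical_map_at_def by metis
  have "((\<lambda>su. f (snd su)) has_derivative (\<lambda>hb. F' (snd hb))) (at (t, v))"
    by (rule has_derivative_compose[of snd]) (use F'(1) in \<open>auto intro!: derivative_eq_intros\<close>)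
  then have "((\<lambda>(s, u). f u) has_derivative (\<lambda>(h, b). cscale h 0 + F' b)) (at (t, v))"
    by (simp add: split_def)
  with F' show ?thesis
    unfolding canonical_at_def
    by (intro exI[of _ 0] exI[of _ F'] exI[of _ "\<lambda>b. 0"]) (simp add: sympl_def zero_prod_def split_def)
qed

definition polynomial_hamiltonian_in ::
  "phase set \<Rightarrow> (complex \<Rightarrow> phase \<Rightarrow> phase) \<Rightarrow> (complex \<Rightarrow> phase \<Rightarrow> complex) \<Rightarrow>
   (phase \<Rightarrow> complex) \<Rightarrow> bool" where
  "polynomial_hamiltonian_in D F H S \<longleftrightarrow>
    (\<forall>t. t \<noteq> 0 \<longrightarrow> t \<noteq> 1 \<longrightarrow> birational_on D (F t) \<and> symplectic_on D (F t)) \<and>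
    (\<exists>K. polynomial_hamiltonian K \<and> transforms_system D F H K \<and>
      (\<forall>t. t \<noteq> 0 \<longrightarrow> t \<noteq> 1 \<longrightarrow> (\<forall>v\<in>D. K t (F t v) = H t v - S v)))"

text \<open>The inverse \<open>G\<close> on \<open>E\<close> does double duty: it witnesses
  birationality and supplies the differentiability needed for the converse direction of the
  transport.\<close>

lemma polynomial_hamiltonian_inI:
  assumes D: "principal_open D" "open D" "regular_map D F"
    and E: "principal_open E" "regular_map E G"
    and FE: "\<And>t v. v \<in> D \<Longrightarrow> F t v \<in> E" and GF: "\<And>t v. v \<in> D \<Longrightarrow> G t (F t v) = v"
    and GD: "\<And>t u. u \<in> E \<Longrightarrow> G t u \<in> D" and FG: "\<And>t u. u \<in> E \<Longrightarrow> F t (G t u) = u"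
    and can: "\<And>t v. v \<in> D \<Longrightarrow> canonical_at F S t v"
    and H: "regular UNIV H" and K: "regular UNIV K" "polynomial_hamiltonian K"
    and KF: "\<And>t v. t \<noteq> 0 \<Longrightarrow> t \<noteq> 1 \<Longrightarrow> v \<in> D \<Longrightarrow> K t (F t v) = H t v - S v"
  shows "polynomial_hamiltonian_in D F H S"
  unfolding polynomial_hamiltonian_in_def
proof (intro conjI allI impI exI[of _ K] ballI)
  fix t :: complex assume t: "t \<noteq> 0" "t \<noteq> 1"
  show "birational_on D (F t)"
    unfolding birational_on_def
    by (intro conjI exI[of _ E] exI[of _ "G t"] ballI)
       (fact D E FE GF GD FG rational_map_on_regular[OF D(3) t] rational_map_on_regular[OF E(2) t])+
  show "symplectic_on D (F t)"
    using can by (rule symplectic_on_canonical)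
next
  show "transforms_system D F H K"
    by (rule transforms_systemI[OF D(2) H K(1) E(2) FE GF can KF])
qed (fact K KF)+

section \<open>The seven charts\<close>

lemma r0_canonical: "fst (snd v) \<noteq> 0 \<Longrightarrow> canonical_map_at (r0 \<alpha>) v"
proof (cases v rule: prod_cases4)
  fix q1 p1 q2 p2 assume p: "fst (snd v) \<noteq> 0" and v: "v = (q1, p1, q2, p2)"
  show ?thesis
    unfolding canonical_map_at_def
  proof (intro exI conjI)
    show "(r0 \<alpha> has_derivative (\<lambda>(a, b, c, d).
        (- (p1^2) * (a - c) - (2 * (q1 - q2) * p1 - \<alpha> 0) * b, - b / p1^2, c, d + b))) (at v)"
      unfolding r0_def split_def using p unfolding v
      by (auto intro!: derivative_eq_intros simp: field_simps power2_eq_square)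
  qed (use p v in \<open>auto simp: cscale_def sympl_def field_simps power2_eq_square\<close>)
qed

lemma r1_canonical: "fst v \<noteq> 0 \<Longrightarrow> canonical_map_at (r1 \<alpha>) v"
proof (cases v rule: prod_cases4)
  fix q1 p1 q2 p2 assume q: "fst v \<noteq> 0" and v: "v = (q1, p1, q2, p2)"
  show ?thesis
    unfolding canonical_map_at_def
  proof (intro exI conjI)
    show "(r1 \<alpha> has_derivative (\<lambda>(a, b, c, d).
        (- a / q1^2, - (2 * q1 * p1 + \<alpha> 1) * a - q1^2 * b, c, d))) (at v)"
      unfolding r1_def split_def using q unfolding v
      by (auto intro!: derivative_eq_intros simp: field_simps power2_eq_square)
  qed (use q v in \<open>auto simp: cscale_def sympl_def field_simps power2_eq_square\<close>)
qed

text \<open>Only \<open>x\<close> depends on time, with time derivative \<open>p1^2\<close>. Pairing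
  \<open>(p1^2, 0, 0, 0)\<close> with a tangent image sees only its second entry
  \<open>- b / p1^2\<close>, giving \<open>- b\<close>, so the correction is
  \<open>p1\<close>.\<close>

lemma r2_canonical:
  "fst (snd v) \<noteq> 0 \<Longrightarrow> canonical_at (r2 \<alpha>) (\<lambda>v. fst (snd v)) t v"
proof (cases v rule: prod_cases4)
  fix q1 p1 q2 p2 assume p: "fst (snd v) \<noteq> 0" and v: "v = (q1, p1, q2, p2)"
  let ?F' = "\<lambda>(a, b, c, d).
        (- (p1^2) * a - (2 * (q1 - t) * p1 - \<alpha> 2) * b, - b / p1^2, c, d)"
  show ?thesis
    unfolding canonical_at_def
  proof (intro exI conjI)
    show "((\<lambda>(s, u). r2 \<alpha> s u) has_derivative
        (\<lambda>(h, b). cscale h (p1^2, 0, 0, 0) + ?F' b)) (at (t, v))"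
      unfolding r2_def split_def using p unfolding v
      by (auto intro!: derivative_eq_intros simp: cscale_def field_simps power2_eq_square)
    show "((\<lambda>v. fst (snd v)) has_derivative (\<lambda>v. fst (snd v))) (at v)"
      by (auto intro!: derivative_eq_intros)
  qed (use p v in \<open>auto simp: cscale_def sympl_def field_simps power2_eq_square\<close>)
qed

lemma r3_canonical: "fst (snd v) \<noteq> 0 \<Longrightarrow> canonical_map_at (r3 \<alpha> \<eta>) v"
proof (cases v rule: prod_cases4)
  fix q1 p1 q2 p2 assume p: "fst (snd v) \<noteq> 0" and v: "v = (q1, p1, q2, p2)"
  show ?thesis
    unfolding canonical_map_at_def
  proof (intro exI conjI)
    show "(r3 \<alpha> \<eta> has_derivative (\<lambda>(a, b, c, d).
        (- (p1^2 * a + q1 * p1 * b + p1 * p2 * c + p1 * q2 * d)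
         - (q1 * p1 + q2 * p2 - (\<alpha> 3 - \<eta>)) * b,
         - b / p1^2, p1 * c + q2 * b, d / p1 - p2 * b / p1^2))) (at v)"
      unfolding r3_def split_def using p unfolding v
      by (auto intro!: derivative_eq_intros simp: field_simps power2_eq_square)
  qed (use p v in \<open>auto simp: cscale_def sympl_def field_simps power2_eq_square\<close>)
qed

lemma r4_canonical: "snd (snd (snd v)) \<noteq> 0 \<Longrightarrow> canonical_map_at (r4 \<alpha>) v"
proof (cases v rule: prod_cases4)
  fix q1 p1 q2 p2 assume p: "snd (snd (snd v)) \<noteq> 0" and v: "v = (q1, p1, q2, p2)"
  show ?thesis
    unfolding canonical_map_at_def
  proof (intro exI conjI)
    show "(r4 \<alpha> has_derivative (\<lambda>(a, b, c, d).
        (a, b, - (p2^2) * c - (2 * (q2 - 1) * p2 - \<alpha> 4) * d, - d / p2^2))) (at v)"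
      unfolding r4_def split_def using p unfolding v
      by (auto intro!: derivative_eq_intros simp: field_simps power2_eq_square)
  qed (use p v in \<open>auto simp: cscale_def sympl_def field_simps power2_eq_square\<close>)
qed

lemma r5_canonical: "fst (snd (snd v)) \<noteq> 0 \<Longrightarrow> canonical_map_at (r5 \<alpha>) v"
proof (cases v rule: prod_cases4)
  fix q1 p1 q2 p2 assume q: "fst (snd (snd v)) \<noteq> 0" and v: "v = (q1, p1, q2, p2)"
  show ?thesis
    unfolding canonical_map_at_def
  proof (intro exI conjI)
    show "(r5 \<alpha> has_derivative (\<lambda>(a, b, c, d).
        (a, b, - c / q2^2, - (2 * q2 * p2 + \<alpha> 5) * c - q2^2 * d))) (at v)"
      unfolding r5_def split_def using q unfolding v
      by (auto intro!: derivative_eq_intros simp: field_simps power2_eq_square)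
  qed (use q v in \<open>auto simp: cscale_def sympl_def field_simps power2_eq_square\<close>)
qed

text \<open>\<open>r1\<close> and \<open>r5\<close> move both positions to infinity, and the last
  step has the shape of \<open>r3\<close>. The constant family with second parameter 0 makes the
  shift \<open>\<alpha> 3 - \<eta>\<close> of \<open>r3\<close> equal to
  \<open>\<eta> - \<alpha> 1 - \<alpha> 5\<close>.\<close>

lemma r6_eq: "r6 \<alpha> \<eta> v = r3 (\<lambda>_. \<eta> - \<alpha> 1 - \<alpha> 5) 0 (r5 \<alpha> (r1 \<alpha> v))"
  by (cases v rule: prod_cases4) (simp add: r6_def r3_def r5_def r1_def Let_def)

lemma r6_canonical:
  assumes "v \<in> r_dom \<alpha> 6"
  shows "canonical_map_at (r6 \<alpha> \<eta>) v"
proof -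
  have *: "fst v \<noteq> 0" "fst (snd (snd (r1 \<alpha> v))) \<noteq> 0" "fst (snd (r5 \<alpha> (r1 \<alpha> v))) \<noteq> 0"
    using assms by (auto simp: r_dom_def r1_def r5_def split_def)
  show ?thesis
    unfolding r6_eq[abs_def]
    by (rule canonical_map_at_compose[of "\<lambda>v. r5 \<alpha> (r1 \<alpha> v)"],
        rule canonical_map_at_compose[of "r1 \<alpha>"])
       (use * in \<open>auto intro: r1_canonical r5_canonical r3_canonical\<close>)
qed

section \<open>The Hamiltonian in the new coordinates\<close>

lemma H_FS_regular: "regular UNIV (H_FS \<alpha> \<eta>)"
  unfolding H_FS_def H_VI_def split_def by (intro regular_intros) auto

text \<open>\<open>Ki\<close> is the Hamiltonian in the \<open>i\<close>-th chart with its poles cancelled by hand.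
  There \<open>q\<close> and \<open>r\<close> stand for the old positions (for \<open>X\<close> and \<open>Z\<close> in \<open>K6\<close>), and \<open>u\<close>, \<open>v\<close>,
  \<open>m\<close>, \<open>n\<close> for products of an old position and momentum, up to signs and shifts, regular
  in the new variables.\<close>

definition K0 :: "(nat \<Rightarrow> complex) \<Rightarrow> complex \<Rightarrow> complex \<Rightarrow> phase \<Rightarrow> complex" where
  "K0 \<alpha> \<eta> t = (\<lambda>(x, y, z, w). let u = \<alpha> 0 - x * y; q = z + u * y in
     (- x * (q * (q - t) - z * (z - 1))
      - u * ((\<alpha> 2 - 1) * (q + z - 1) + \<alpha> 4 * (q + z - t) + (\<alpha> 3 - \<eta>) * (q + z - 1 - t)
             + \<alpha> 5 * (q - t) + \<alpha> 1 * (z - 1))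
      + u * w * (z - 1) * (q - t + 2 * z)
      + H_VI t z w (\<alpha> 0 + \<alpha> 2) (\<alpha> 4) (\<alpha> 3 + \<alpha> 1 - \<eta>) (\<eta> * \<alpha> 5)
      + \<alpha> 1 * (q - t) * (z - 1) * w + \<eta> * \<alpha> 1 * q) / (t * (t - 1)))"

definition K1 :: "(nat \<Rightarrow> complex) \<Rightarrow> complex \<Rightarrow> complex \<Rightarrow> phase \<Rightarrow> complex" where
  "K1 \<alpha> \<eta> t = (\<lambda>(x, y, z, w). let v = x * y + \<alpha> 1 in
     (y * (v - \<eta>) - v^2 * (1 + t - t * x)
      - v * (\<alpha> 2 - 1 + (\<alpha> 0 + \<alpha> 4) * t + (\<alpha> 3 + \<alpha> 5 - \<eta>) * (1 + t - t * x))
      + H_VI t z w (\<alpha> 0 + \<alpha> 2) (\<alpha> 4) (\<alpha> 3 + \<alpha> 1 - \<eta>) (\<eta> * \<alpha> 5)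
      - (1 - t * x) * (z - 1) * (y * w + v * (z * w + \<alpha> 5))) / (t * (t - 1)))"

definition K2 :: "(nat \<Rightarrow> complex) \<Rightarrow> complex \<Rightarrow> complex \<Rightarrow> phase \<Rightarrow> complex" where
  "K2 \<alpha> \<eta> t = (\<lambda>(x, y, z, w). let u = \<alpha> 2 - x * y; q = t + u * y in
     (- x * q * (q - 1) + u * (q + t - 1) - (\<alpha> 0 + \<alpha> 4) * q * u
      - (\<alpha> 3 + \<alpha> 5 - \<eta>) * (q - 1) * u + \<eta> * \<alpha> 1 * q
      + H_VI t z w (\<alpha> 0 + \<alpha> 2) (\<alpha> 4) (\<alpha> 3 + \<alpha> 1 - \<eta>) (\<eta> * \<alpha> 5)
      + u * (z - 1) * ((q + z) * w + \<alpha> 1 * y * w + \<alpha> 5)) / (t * (t - 1)))"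

definition K3 :: "(nat \<Rightarrow> complex) \<Rightarrow> complex \<Rightarrow> complex \<Rightarrow> phase \<Rightarrow> complex" where
  "K3 \<alpha> \<eta> t = (\<lambda>(x, y, z, w).
     let c = \<alpha> 3 - \<eta>; m = z * w; u = c - x * y - m; q = u * y; r = z * y in
     (u * (q - 1 - t) * (u - c - \<alpha> 5) + m * (r - 1 - t) * (m - c - \<alpha> 1)
      + (u * r - u - t * z) * ((u + \<alpha> 1) * w + m + \<alpha> 5) - t * x * (1 + w)
      - (\<alpha> 2 - 1) * u * (q - 1) - (\<alpha> 0 + \<alpha> 4) * u * (q - t)
      - (\<alpha> 0 + \<alpha> 2 - 1) * m * (r - 1) - \<alpha> 4 * m * (r - t)
      + \<eta> * (\<alpha> 1 * q + \<alpha> 5 * r)) / (t * (t - 1)))"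

definition K4 :: "(nat \<Rightarrow> complex) \<Rightarrow> complex \<Rightarrow> complex \<Rightarrow> phase \<Rightarrow> complex" where
  "K4 \<alpha> \<eta> t = (\<lambda>(x, y, z, w). let u = \<alpha> 4 - z * w; q = 1 + u * w in
     (H_VI t x y (\<alpha> 2) (\<alpha> 0 + \<alpha> 4) (\<alpha> 3 + \<alpha> 5 - \<eta>) (\<eta> * \<alpha> 1)
      - q * (q - t) * z - (\<alpha> 0 + \<alpha> 2 - 1) * q * u - (\<alpha> 3 + \<alpha> 1 - \<eta>) * u * (q - t)
      + \<eta> * \<alpha> 5 * q + (x - t) * u * (x * y + \<alpha> 1 + y * q + \<alpha> 5 * y * w)) / (t * (t - 1)))"

definition K5 :: "(nat \<Rightarrow> complex) \<Rightarrow> complex \<Rightarrow> complex \<Rightarrow> phase \<Rightarrow> complex" where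
  "K5 \<alpha> \<eta> t = (\<lambda>(x, y, z, w). let v = z * w + \<alpha> 5 in
     (H_VI t x y (\<alpha> 2) (\<alpha> 0 + \<alpha> 4) (\<alpha> 3 + \<alpha> 5 - \<eta>) (\<eta> * \<alpha> 1)
      + w * (v - \<eta>) - v^2 * (1 + t - t * z)
      - v * (\<alpha> 0 + \<alpha> 2 - 1 + \<alpha> 4 * t + (\<alpha> 3 + \<alpha> 1 - \<eta>) * (1 + t - t * z))
      - (x - t) * (1 - z) * ((x * y + \<alpha> 1) * v + y * w)) / (t * (t - 1)))"

definition K6 :: "(nat \<Rightarrow> complex) \<Rightarrow> complex \<Rightarrow> complex \<Rightarrow> phase \<Rightarrow> complex" where
  "K6 \<alpha> \<eta> t = (\<lambda>(x, y, z, w).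
     let u = \<eta> - \<alpha> 1 - \<alpha> 5 - x * y - z * w; q = u * y; r = z * y;
         v = u + \<alpha> 1; n = z * w + \<alpha> 5 in
     (- x * (1 + w) - v^2 * (1 + t - t * q)
      - v * (\<alpha> 2 - 1 + (\<alpha> 0 + \<alpha> 4) * t + (\<alpha> 3 + \<alpha> 5 - \<eta>) * (1 + t - t * q))
      - n^2 * (1 + t - t * r)
      - n * (\<alpha> 0 + \<alpha> 2 - 1 + \<alpha> 4 * t + (\<alpha> 3 + \<alpha> 1 - \<eta>) * (1 + t - t * r))
      + (t * u * r - t * u - z) * (n + v * w)) / (t * (t - 1)))"

lemma K_polynomial:
  "polynomial_hamiltonian (K0 \<alpha> \<eta>)" "polynomial_hamiltonian (K1 \<alpha> \<eta>)"
  "polynomial_hamiltonian (K2 \<alpha> \<eta>)" "polynomial_hamiltonian (K3 \<alpha> \<eta>)"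
  "polynomial_hamiltonian (K4 \<alpha> \<eta>)" "polynomial_hamiltonian (K5 \<alpha> \<eta>)"
  "polynomial_hamiltonian (K6 \<alpha> \<eta>)"
  unfolding K0_def K1_def K2_def K3_def K4_def K5_def K6_def H_VI_def split_def Let_def
  by (intro polynomial_hamiltonian_intros)+

lemma K_regular:
  "regular UNIV (K0 \<alpha> \<eta>)" "regular UNIV (K1 \<alpha> \<eta>)" "regular UNIV (K2 \<alpha> \<eta>)"
  "regular UNIV (K3 \<alpha> \<eta>)" "regular UNIV (K4 \<alpha> \<eta>)" "regular UNIV (K5 \<alpha> \<eta>)"
  "regular UNIV (K6 \<alpha> \<eta>)"
  unfolding K0_def K1_def K2_def K3_def K4_def K5_def K6_def H_VI_def split_def Let_def
  by ((intro regular_intros)?; simp)+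

context
  fixes \<alpha> :: "nat \<Rightarrow> complex" and \<eta> t :: complex
  assumes sum: "\<alpha> 0 + \<alpha> 1 + \<alpha> 2 + \<alpha> 3 + \<alpha> 4 + \<alpha> 5 = 1"
begin

text \<open>With \<open>p2 = w - p1\<close>, the coefficient of \<open>p1^2\<close> is
  \<open>(q1 - q2) * (q1 * (q1 - t) - q2 * (q2 - 1))\<close>. Since
  \<open>(q1 - q2) * p1 = \<alpha> 0 - x * y\<close>, it leaves a regular term and a multiple of
  \<open>\<alpha> 0 * p1\<close>, which cancels against the \<open>\<alpha> 0\<close> parts of the
  two \<open>H_VI\<close>; the other terms linear in \<open>p1\<close> combine to multiples of
  \<open>q1 - q2\<close>.\<close>

lemma K0_r0: "p1 \<noteq> 0 \<Longrightarrow> K0 \<alpha> \<eta> t (r0 \<alpha> (q1, p1, q2, p2)) = H_FS \<alpha> \<eta> t (q1, p1, q2, p2)"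
proof -
  assume "p1 \<noteq> 0"
  \<comment> \<open>\<open>algebra\<close> treats \<open>1 / p1\<close> as an atom, and this
    equation tells it what is needed. Both sides are divided by \<open>t * (t - 1)\<close>, so
    comparing numerators suffices.\<close>
  then have "p1 * (1 / p1) = 1"
    by simp
  then show ?thesis
    unfolding K0_def r0_def H_FS_def prod.case Let_def H_VI_def
    using sum by (intro arg_cong2[where f = "(/)"] refl) algebra
qed

text \<open>By \<open>sum\<close>, the part of \<open>H_VI\<close> with leading growth in
  \<open>q1\<close> is \<open>q1 * (q1 * p1 + \<alpha> 1) * (q1 * p1 + \<eta>)\<close>, which is
  \<open>y * (v - \<eta>)\<close>; the coupling term absorbs its factor \<open>q1\<close> in the
  same way.\<close>

lemma K1_r1: "q1 \<noteq> 0 \<Longrightarrow> K1 \<alpha> \<eta> t (r1 \<alpha> (q1, p1, q2, p2)) = H_FS \<alpha> \<eta> t (q1, p1, q2, p2)"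
proof -
  assume "q1 \<noteq> 0"
  then have "q1 * (1 / q1) = 1"
    by simp
  then show ?thesis
    unfolding K1_def r1_def H_FS_def prod.case Let_def H_VI_def
    using sum by (intro arg_cong2[where f = "(/)"] refl) algebra
qed

text \<open>Put \<open>u = (q1 - t) * p1\<close>, so \<open>u - \<alpha> 2 = - x * y\<close>. The
  singular terms are \<open>q1 * (q1 - 1) * p1 * (u - \<alpha> 2 + 1)\<close>, whose remaining pole
  is \<open>q1 * (q1 - 1) * p1\<close>. Subtracting \<open>t * (t - 1) * p1\<close> turns it into
  \<open>u * (q1 + t - 1)\<close>.\<close>

lemma K2_r2:
  assumes "p1 \<noteq> 0" "t \<noteq> 0" "t \<noteq> 1"
  shows "K2 \<alpha> \<eta> t (r2 \<alpha> t (q1, p1, q2, p2)) = H_FS \<alpha> \<eta> t (q1, p1, q2, p2) - p1"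
proof -
  have "p1 * (1 / p1) = 1"
    using assms(1) by simp
  \<comment> \<open>The correction must come under the common denominator before numerators can be
    compared; this uses \<open>t \<noteq> 0\<close> and \<open>t \<noteq> 1\<close>.\<close>
  moreover have "a / (t * (t - 1)) - p1 = (a - p1 * (t * (t - 1))) / (t * (t - 1))" for a
    using assms(2,3) by (simp add: diff_divide_distrib)
  ultimately show ?thesis
    unfolding K2_def r2_def H_FS_def prod.case Let_def H_VI_def
    using sum by (simp only:, intro arg_cong2[where f = "(/)"] refl) algebra
qed

text \<open>Setting \<open>q1 = q2 = 0\<close> in the polynomial prefactors, while keeping
  \<open>q1 * p1\<close> and \<open>q2 * p2\<close>, leaves the singular part. There
  \<open>\<alpha> 1\<close> and \<open>\<alpha> 5\<close> cancel between the \<open>H_VI\<close>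
  terms and the coupling, and \<open>t * (p1 + p2) * (q1 * p1 + q2 * p2 - (\<alpha> 3 - \<eta>)) = -
  t * x * (1 + w)\<close> remains.\<close>

lemma K3_r3:
  "p1 \<noteq> 0 \<Longrightarrow> K3 \<alpha> \<eta> t (r3 \<alpha> \<eta> (q1, p1, q2, p2)) = H_FS \<alpha> \<eta> t (q1, p1, q2, p2)"
proof -
  assume "p1 \<noteq> 0"
  then have "p1 * (1 / p1) = 1" "p1 * (p2 / p1) = p2"
    by simp_all
  then show ?thesis
    unfolding K3_def r3_def H_FS_def prod.case Let_def H_VI_def
    by (intro arg_cong2[where f = "(/)"] refl) algebra
qed

text \<open>The singular part is \<open>q2 * (q2 - t) * p2 * ((q2 - 1) * p2 - \<alpha> 4)\<close>,
  equal to \<open>- q2 * (q2 - t) * z\<close>; the factor \<open>q2 - 1\<close> already makes the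
  coupling regular.\<close>

lemma K4_r4: "p2 \<noteq> 0 \<Longrightarrow> K4 \<alpha> \<eta> t (r4 \<alpha> (q1, p1, q2, p2)) = H_FS \<alpha> \<eta> t (q1, p1, q2, p2)"
proof -
  assume "p2 \<noteq> 0"
  then have "p2 * (1 / p2) = 1"
    by simp
  then show ?thesis
    unfolding K4_def r4_def H_FS_def prod.case Let_def H_VI_def
    by (intro arg_cong2[where f = "(/)"] refl) algebra
qed

text \<open>At infinite \<open>q2\<close> the same use of \<open>sum\<close> produces the factors
  \<open>q2 * p2 + \<alpha> 5\<close> and \<open>q2 * p2 + \<eta>\<close>.\<close>

lemma K5_r5: "q2 \<noteq> 0 \<Longrightarrow> K5 \<alpha> \<eta> t (r5 \<alpha> (q1, p1, q2, p2)) = H_FS \<alpha> \<eta> t (q1, p1, q2, p2)"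
proof -
  assume "q2 \<noteq> 0"
  then have "q2 * (1 / q2) = 1"
    by simp
  then show ?thesis
    unfolding K5_def r5_def H_FS_def prod.case Let_def H_VI_def
    using sum by (intro arg_cong2[where f = "(/)"] refl) algebra
qed

text \<open>The Hamiltonian is already polynomial in the intermediate coordinates \<open>(X, Y, Z, W)\<close>.
  Substituting \<open>Y = 1 / y\<close>, \<open>W = w / y\<close>, its only contribution with a pole at \<open>y = 0\<close> is
  \<open>(Y + W) (X Y + Z W - (\<eta> - \<alpha> 1 - \<alpha> 5))\<close>, which is \<open>- x (1 + w)\<close>.\<close>

lemma K6_r6:
  assumes "q1 \<noteq> 0" "q2 \<noteq> 0" "q1 * p1 + \<alpha> 1 \<noteq> 0"
  shows "K6 \<alpha> \<eta> t (r6 \<alpha> \<eta> (q1, p1, q2, p2)) = H_FS \<alpha> \<eta> t (q1, p1, q2, p2)"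
proof -
  define X Y Z W where X_def: "X = 1 / q1" and Y: "Y = - (q1 * p1 + \<alpha> 1) * q1"
    and Z_def: "Z = 1 / q2" and W: "W = - (q2 * p2 + \<alpha> 5) * q2"
  then have X: "X * q1 = 1" and Z: "Z * q2 = 1"
    using assms by simp_all
  define v n where vn: "v = X * Y + \<alpha> 1" "n = Z * W + \<alpha> 5"
  define N where N: "N = Y * (v - \<eta>) + W * (n - \<eta>)
      - v^2 * (1 + t - t * X)
      - v * (\<alpha> 2 - 1 + (\<alpha> 0 + \<alpha> 4) * t + (\<alpha> 3 + \<alpha> 5 - \<eta>) * (1 + t - t * X))
      - n^2 * (1 + t - t * Z)
      - n * (\<alpha> 0 + \<alpha> 2 - 1 + \<alpha> 4 * t + (\<alpha> 3 + \<alpha> 1 - \<eta>) * (1 + t - t * Z))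
      + (1 - t * X) * (1 - Z) * (Y * n + v * W)"
  have "H_FS \<alpha> \<eta> t (q1, p1, q2, p2) = N / (t * (t - 1))"
    unfolding H_FS_def prod.case H_VI_def
  proof (intro arg_cong2[where f = "(/)"] refl)
    have v: "v = - q1 * p1" and n: "n = - q2 * p2"
      using X Z unfolding vn Y W by algebra+
    have 1: "q1 * (q1 - 1) * (q1 - t) * p1^2 - ((\<alpha> 2 - 1) * q1 * (q1 - 1) + (\<alpha> 0 + \<alpha> 4) * q1 * (q1 - t)
        + (\<alpha> 3 + \<alpha> 5 - \<eta>) * (q1 - 1) * (q1 - t)) * p1 + \<eta> * \<alpha> 1 * q1
      = Y * (v - \<eta>) - v^2 * (1 + t - t * X)
      - v * (\<alpha> 2 - 1 + (\<alpha> 0 + \<alpha> 4) * t + (\<alpha> 3 + \<alpha> 5 - \<eta>) * (1 + t - t * X))"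
      using X sum unfolding v Y by algebra
    have 2: "q2 * (q2 - 1) * (q2 - t) * p2^2 - ((\<alpha> 0 + \<alpha> 2 - 1) * q2 * (q2 - 1) + \<alpha> 4 * q2 * (q2 - t)
        + (\<alpha> 3 + \<alpha> 1 - \<eta>) * (q2 - 1) * (q2 - t)) * p2 + \<eta> * \<alpha> 5 * q2
      = W * (n - \<eta>) - n^2 * (1 + t - t * Z)
      - n * (\<alpha> 0 + \<alpha> 2 - 1 + \<alpha> 4 * t + (\<alpha> 3 + \<alpha> 1 - \<eta>) * (1 + t - t * Z))"
      using Z sum unfolding n W by algebra
    \<comment> \<open>Write \<open>q1 - t = q1 * (1 - t * X)\<close> and
      \<open>q2 - 1 = q2 * (1 - Z)\<close>; the factors \<open>q1\<close> and \<open>q2\<close> then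
      complete \<open>Y\<close>, \<open>W\<close>, \<open>v\<close> and \<open>n\<close>.\<close>
    have 3: "(q1 - t) * (q2 - 1) * ((q1 * p1 + \<alpha> 1) * p2 + p1 * (q2 * p2 + \<alpha> 5))
      = (1 - t * X) * (1 - Z) * (Y * n + v * W)"
      using X Z unfolding v n Y W by algebra
    show "q1 * (q1 - 1) * (q1 - t) * p1^2 - ((\<alpha> 2 - 1) * q1 * (q1 - 1) + (\<alpha> 0 + \<alpha> 4) * q1 * (q1 - t)
        + (\<alpha> 3 + \<alpha> 5 - \<eta>) * (q1 - 1) * (q1 - t)) * p1 + \<eta> * \<alpha> 1 * q1
      + (q2 * (q2 - 1) * (q2 - t) * p2^2 - ((\<alpha> 0 + \<alpha> 2 - 1) * q2 * (q2 - 1) + \<alpha> 4 * q2 * (q2 - t)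
        + (\<alpha> 3 + \<alpha> 1 - \<eta>) * (q2 - 1) * (q2 - t)) * p2 + \<eta> * \<alpha> 5 * q2)
      + (q1 - t) * (q2 - 1) * ((q1 * p1 + \<alpha> 1) * p2 + p1 * (q2 * p2 + \<alpha> 5)) = N"
      unfolding 1 2 3 N by simp
  qed
  moreover have "K6 \<alpha> \<eta> t (r6 \<alpha> \<eta> (q1, p1, q2, p2)) = N / (t * (t - 1))"
  proof -
    define x y w where x: "x = - (X * Y + Z * W - (\<eta> - \<alpha> 1 - \<alpha> 5)) * Y"
      and y_def: "y = 1 / Y" and w_def: "w = W / Y"
    have "Y \<noteq> 0"
      using assms by (auto simp: Y add_eq_0_iff)
    then have y: "y * Y = 1" and w: "w * Y = W"
      by (simp_all add: y_def w_def)
    have r6: "r6 \<alpha> \<eta> (q1, p1, q2, p2) = (x, y, Z * Y, w)"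
      by (simp add: r6_def Let_def X_def Z_def Y W x y_def w_def)
    have u: "\<eta> - \<alpha> 1 - \<alpha> 5 - x * y - Z * W = X * Y"
      using y unfolding x by algebra
    have q: "X * Y * y = X" "Z * Y * y = Z" and m: "Z * Y * w = Z * W"
      using y w by algebra+
    \<comment> \<open>In the expansion of \<open>(1 - t * X) * (1 - Z)\<close> every term but the
      leading 1 contains \<open>X\<close> or \<open>Z\<close> and so absorbs the factor
      \<open>Y\<close>; the leading 1 joins \<open>Y * (v - \<eta>) + W * (n - \<eta>)\<close> to
      form \<open>- x * (1 + w)\<close>.\<close>
    have *: "- x * (1 + w) + (t * (X * Y) * Z - t * (X * Y) - Z * Y) * (n + v * w)
      = Y * (v - \<eta>) + W * (n - \<eta>) + (1 - t * X) * (1 - Z) * (Y * n + v * W)"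
      unfolding x vn w[symmetric] by algebra
    show ?thesis
      unfolding K6_def r6 prod.case Let_def m u q vn[symmetric] N
      by (intro arg_cong2[where f = "(/)"] refl) (use * in algebra)
  qed
  ultimately show ?thesis
    by simp
qed

end

text \<open>Each domain as the nonvanishing set of one polynomial, the form that
  \<open>principal_openI\<close> and the openness proofs expect.\<close>

lemma r_dom_eq:
  "r_dom \<alpha> 0 = {v. fst (snd v) \<noteq> 0}" "r_dom \<alpha> 1 = {v. fst v \<noteq> 0}"
  "r_dom \<alpha> 2 = {v. fst (snd v) \<noteq> 0}" "r_dom \<alpha> 3 = {v. fst (snd v) \<noteq> 0}"
  "r_dom \<alpha> 4 = {v. snd (snd (snd v)) \<noteq> 0}" "r_dom \<alpha> 5 = {v. fst (snd (snd v)) \<noteq> 0}"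
  "r_dom \<alpha> 6 = {v. fst v * fst (snd (snd v)) * (fst v * fst (snd v) + \<alpha> 1) \<noteq> 0}"
  by (auto simp: r_dom_def eval_nat_numeral add_eq_0_iff)

lemma principal_open_coords:
  "principal_open {v. fst v \<noteq> 0}" "principal_open {v. fst (snd v) \<noteq> 0}"
  "principal_open {v. fst (snd (snd v)) \<noteq> 0}" "principal_open {v. snd (snd (snd v)) \<noteq> 0}"
  by (rule principal_openI[where v\<^sub>0 = "(1, 1, 1, 1)"], rule poly_fun_coords, simp, simp)+

lemma open_coords:
  "open {v :: phase. fst v \<noteq> 0}" "open {v :: phase. fst (snd v) \<noteq> 0}"
  "open {v :: phase. fst (snd (snd v)) \<noteq> 0}" "open {v :: phase. snd (snd (snd v)) \<noteq> 0}"
  by (intro open_Collect_neq continuous_intros)+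

section \<open>Inverse maps and verification chart by chart\<close>

lemma chart_r0:
  assumes "\<alpha> 0 + \<alpha> 1 + \<alpha> 2 + \<alpha> 3 + \<alpha> 4 + \<alpha> 5 = 1"
  shows  "polynomial_hamiltonian_in (r_dom \<alpha> 0) (\<lambda>t. r0 \<alpha>) (H_FS \<alpha> \<eta>) (\<lambda>v. 0)"
  unfolding r_dom_eq
\<comment> \<open>The inverse comes from \<open>(q1 - q2) * p1 = \<alpha> 0 - x * y\<close> with
  \<open>p1 = 1 / y\<close> and \<open>q2 = z\<close>.\<close>
proof (rule polynomial_hamiltonian_inI[where E = "{v. fst (snd v) \<noteq> 0}" and K = "K0 \<alpha> \<eta>"
      and G = "\<lambda>t (x, y, z, w). (z + (\<alpha> 0 - x * y) * y, 1 / y, z, w - 1 / y)"])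
  show "regular_map {v. fst (snd v) \<noteq> 0} (\<lambda>t. r0 \<alpha>)"
    unfolding regular_map_def r0_def split_def by (auto intro!: regular_intros)
  show "regular_map {v. fst (snd v) \<noteq> 0}
      (\<lambda>t (x, y, z, w). (z + (\<alpha> 0 - x * y) * y, 1 / y, z, w - 1 / y))"
    unfolding regular_map_def split_def by (auto intro!: regular_intros)
  show "canonical_at (\<lambda>t. r0 \<alpha>) (\<lambda>v. 0) t v" if "v \<in> {v. fst (snd v) \<noteq> 0}" for t v
    using that by (intro canonical_at_autonomous r0_canonical) simp
  show "K0 \<alpha> \<eta> t (r0 \<alpha> v) = H_FS \<alpha> \<eta> t v - 0" if "v \<in> {v. fst (snd v) \<noteq> 0}" for t v
    using that K0_r0[OF assms] by (cases v rule: prod_cases4) simp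
qed (auto simp: r0_def field_simps
       intro: principal_open_coords open_coords H_FS_regular K_regular K_polynomial)

lemma chart_r1:
  assumes "\<alpha> 0 + \<alpha> 1 + \<alpha> 2 + \<alpha> 3 + \<alpha> 4 + \<alpha> 5 = 1"
  shows  "polynomial_hamiltonian_in (r_dom \<alpha> 1) (\<lambda>t. r1 \<alpha>) (H_FS \<alpha> \<eta>) (\<lambda>v. 0)"
  unfolding r_dom_eq
\<comment> \<open>The map is its own inverse: \<open>x * y + \<alpha> 1 = - q1 * p1\<close>, so
  applying the second component again returns \<open>p1\<close>.\<close>
proof (rule polynomial_hamiltonian_inI[where E = "{v. fst v \<noteq> 0}" and K = "K1 \<alpha> \<eta>"
      and G = "\<lambda>t. r1 \<alpha>"])
  show "regular_map {v. fst v \<noteq> 0} (\<lambda>t. r1 \<alpha>)"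
    unfolding regular_map_def r1_def split_def by (auto intro!: regular_intros)
  show "regular_map {v. fst v \<noteq> 0}
      (\<lambda>t. r1 \<alpha>)"
    unfolding regular_map_def r1_def split_def by (auto intro!: regular_intros)
  show "canonical_at (\<lambda>t. r1 \<alpha>) (\<lambda>v. 0) t v" if "v \<in> {v. fst v \<noteq> 0}" for t v
    using that by (intro canonical_at_autonomous r1_canonical) simp
  show "K1 \<alpha> \<eta> t (r1 \<alpha> v) = H_FS \<alpha> \<eta> t v - 0" if "v \<in> {v. fst v \<noteq> 0}" for t v
    using that K1_r1[OF assms] by (cases v rule: prod_cases4) simp
qed (auto simp: r1_def field_simps
       intro: principal_open_coords open_coords H_FS_regular K_regular K_polynomial)

lemma chart_r2:
  assumes "\<alpha> 0 + \<alpha> 1 + \<alpha> 2 + \<alpha> 3 + \<alpha> 4 + \<alpha> 5 = 1"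
  shows  "polynomial_hamiltonian_in (r_dom \<alpha> 2) (r2 \<alpha>) (H_FS \<alpha> \<eta>) (\<lambda>v. fst (snd v))"
  unfolding r_dom_eq
proof (rule polynomial_hamiltonian_inI[where E = "{v. fst (snd v) \<noteq> 0}" and K = "K2 \<alpha> \<eta>"
      and G = "\<lambda>t (x, y, z, w). (t + (\<alpha> 2 - x * y) * y, 1 / y, z, w)"])
  show "regular_map {v. fst (snd v) \<noteq> 0} (r2 \<alpha>)"
    unfolding regular_map_def r2_def split_def by (auto intro!: regular_intros)
  show "regular_map {v. fst (snd v) \<noteq> 0}
      (\<lambda>t (x, y, z, w). (t + (\<alpha> 2 - x * y) * y, 1 / y, z, w))"
    unfolding regular_map_def split_def by (auto intro!: regular_intros)
  show "canonical_at (r2 \<alpha>) (\<lambda>v. fst (snd v)) t v" if "v \<in> {v. fst (snd v) \<noteq> 0}" for t v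
    using that by (intro r2_canonical) simp
  show "K2 \<alpha> \<eta> t (r2 \<alpha> t v) = H_FS \<alpha> \<eta> t v - fst (snd v)" if "t \<noteq> 0" "t \<noteq> 1" "v \<in> {v. fst (snd v) \<noteq> 0}" for t v
    using that K2_r2[OF assms] by (cases v rule: prod_cases4) simp
qed (auto simp: r2_def field_simps
       intro: principal_open_coords open_coords H_FS_regular K_regular K_polynomial)

text \<open>Solved from \<open>z * w = q2 * p2\<close> and
  \<open>q1 * p1 = \<alpha> 3 - \<eta> - x * y - z * w\<close>.\<close>

definition r3_inv :: "(nat \<Rightarrow> complex) \<Rightarrow> complex \<Rightarrow> phase \<Rightarrow> phase" where
  "r3_inv \<alpha> \<eta> = (\<lambda>(x, y, z, w). ((\<alpha> 3 - \<eta> - x * y - z * w) * y, 1 / y, z * y, w / y))"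

lemma chart_r3:
  assumes "\<alpha> 0 + \<alpha> 1 + \<alpha> 2 + \<alpha> 3 + \<alpha> 4 + \<alpha> 5 = 1"
  shows  "polynomial_hamiltonian_in (r_dom \<alpha> 3) (\<lambda>t. r3 \<alpha> \<eta>) (H_FS \<alpha> \<eta>) (\<lambda>v. 0)"
  unfolding r_dom_eq
proof (rule polynomial_hamiltonian_inI[where E = "{v. fst (snd v) \<noteq> 0}" and K = "K3 \<alpha> \<eta>"
      and G = "\<lambda>t. r3_inv \<alpha> \<eta>"])
  show "regular_map {v. fst (snd v) \<noteq> 0} (\<lambda>t. r3 \<alpha> \<eta>)"
    unfolding regular_map_def r3_def split_def by (auto intro!: regular_intros)
  show "regular_map {v. fst (snd v) \<noteq> 0}
      (\<lambda>t. r3_inv \<alpha> \<eta>)"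
    unfolding regular_map_def r3_inv_def split_def by (auto intro!: regular_intros)
  show "canonical_at (\<lambda>t. r3 \<alpha> \<eta>) (\<lambda>v. 0) t v" if "v \<in> {v. fst (snd v) \<noteq> 0}" for t v
    using that by (intro canonical_at_autonomous r3_canonical) simp
  show "K3 \<alpha> \<eta> t (r3 \<alpha> \<eta> v) = H_FS \<alpha> \<eta> t v - 0" if "v \<in> {v. fst (snd v) \<noteq> 0}" for t v
    using that K3_r3[OF assms] by (cases v rule: prod_cases4) simp
qed (auto simp: r3_def r3_inv_def field_simps
       intro: principal_open_coords open_coords H_FS_regular K_regular K_polynomial)

lemma chart_r4:
  assumes "\<alpha> 0 + \<alpha> 1 + \<alpha> 2 + \<alpha> 3 + \<alpha> 4 + \<alpha> 5 = 1"
  shows  "polynomial_hamiltonian_in (r_dom \<alpha> 4) (\<lambda>t. r4 \<alpha>) (H_FS \<alpha> \<eta>) (\<lambda>v. 0)"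
  unfolding r_dom_eq
proof (rule polynomial_hamiltonian_inI[where E = "{v. snd (snd (snd v)) \<noteq> 0}" and K = "K4 \<alpha> \<eta>"
      and G = "\<lambda>t (x, y, z, w). (x, y, 1 + (\<alpha> 4 - z * w) * w, 1 / w)"])
  show "regular_map {v. snd (snd (snd v)) \<noteq> 0} (\<lambda>t. r4 \<alpha>)"
    unfolding regular_map_def r4_def split_def by (auto intro!: regular_intros)
  show "regular_map {v. snd (snd (snd v)) \<noteq> 0}
      (\<lambda>t (x, y, z, w). (x, y, 1 + (\<alpha> 4 - z * w) * w, 1 / w))"
    unfolding regular_map_def split_def by (auto intro!: regular_intros)
  show "canonical_at (\<lambda>t. r4 \<alpha>) (\<lambda>v. 0) t v" if "v \<in> {v. snd (snd (snd v)) \<noteq> 0}" for t v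
    using that by (intro canonical_at_autonomous r4_canonical) simp
  show "K4 \<alpha> \<eta> t (r4 \<alpha> v) = H_FS \<alpha> \<eta> t v - 0" if "v \<in> {v. snd (snd (snd v)) \<noteq> 0}" for t v
    using that K4_r4[OF assms] by (cases v rule: prod_cases4) simp
qed (auto simp: r4_def field_simps
       intro: principal_open_coords open_coords H_FS_regular K_regular K_polynomial)

lemma chart_r5:
  assumes "\<alpha> 0 + \<alpha> 1 + \<alpha> 2 + \<alpha> 3 + \<alpha> 4 + \<alpha> 5 = 1"
  shows  "polynomial_hamiltonian_in (r_dom \<alpha> 5) (\<lambda>t. r5 \<alpha>) (H_FS \<alpha> \<eta>) (\<lambda>v. 0)"
  unfolding r_dom_eq
proof (rule polynomial_hamiltonian_inI[where E = "{v. fst (snd (snd v)) \<noteq> 0}" and K = "K5 \<alpha> \<eta>"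
      and G = "\<lambda>t. r5 \<alpha>"])
  show "regular_map {v. fst (snd (snd v)) \<noteq> 0} (\<lambda>t. r5 \<alpha>)"
    unfolding regular_map_def r5_def split_def by (auto intro!: regular_intros)
  show "regular_map {v. fst (snd (snd v)) \<noteq> 0}
      (\<lambda>t. r5 \<alpha>)"
    unfolding regular_map_def r5_def split_def by (auto intro!: regular_intros)
  show "canonical_at (\<lambda>t. r5 \<alpha>) (\<lambda>v. 0) t v" if "v \<in> {v. fst (snd (snd v)) \<noteq> 0}" for t v
    using that by (intro canonical_at_autonomous r5_canonical) simp
  show "K5 \<alpha> \<eta> t (r5 \<alpha> v) = H_FS \<alpha> \<eta> t v - 0" if "v \<in> {v. fst (snd (snd v)) \<noteq> 0}" for t v
    using that K5_r5[OF assms] by (cases v rule: prod_cases4) simp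
qed (auto simp: r5_def field_simps
       intro: principal_open_coords open_coords H_FS_regular K_regular K_polynomial)

lemma r1_involution: "fst v \<noteq> 0 \<Longrightarrow> r1 \<alpha> (r1 \<alpha> v) = v"
  by (cases v rule: prod_cases4) (simp add: r1_def field_simps)

lemma r5_involution: "fst (snd (snd v)) \<noteq> 0 \<Longrightarrow> r5 \<alpha> (r5 \<alpha> v) = v"
  by (cases v rule: prod_cases4) (simp add: r5_def field_simps)

lemma r3_inv:
  assumes "fst (snd v) \<noteq> 0"
  shows "r3_inv \<alpha> \<eta> (r3 \<alpha> \<eta> v) = v" "r3 \<alpha> \<eta> (r3_inv \<alpha> \<eta> v) = v"
  using assms by (cases v rule: prod_cases4; simp add: r3_def r3_inv_def field_simps)+

lemma chart_r6:
  assumes "\<alpha> 0 + \<alpha> 1 + \<alpha> 2 + \<alpha> 3 + \<alpha> 4 + \<alpha> 5 = 1"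
  shows "polynomial_hamiltonian_in (r_dom \<alpha> 6) (\<lambda>t. r6 \<alpha> \<eta>) (H_FS \<alpha> \<eta>) (\<lambda>v. 0)"
proof (rule polynomial_hamiltonian_inI)
  define c where "c = \<eta> - \<alpha> 1 - \<alpha> 5"
  let ?D = "r_dom \<alpha> 6"
  \<comment> \<open>The image of the domain: its factors are \<open>1 / Y\<close>,
    \<open>Z * Y\<close> and \<open>X * Y\<close> in the intermediate coordinates, the last being
    \<open>c - x * y - z * w\<close>.\<close>
  let ?E = "{v. fst (snd v) * fst (snd (snd v)) *
    (c - fst v * fst (snd v) - fst (snd (snd v)) * snd (snd (snd v))) \<noteq> 0}"
  let ?G = "\<lambda>u. r1 \<alpha> (r5 \<alpha> (r3_inv (\<lambda>_. c) 0 u))"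
  \<comment> \<open>At the chosen point \<open>q1 * p1 + \<alpha> 1 = 1\<close>; the point for
    \<open>?E\<close> below similarly makes \<open>c - x * y - z * w = 1\<close>.\<close>
  show "principal_open ?D"
    by (rule principal_openI[OF _ _ r_dom_eq(7), where v\<^sub>0 = "(1, 1 - \<alpha> 1, 1, 0)"])
       (auto intro!: poly_fun_intros)
  show "open ?D"
    unfolding r_dom_eq by (intro open_Collect_neq continuous_intros)
  show "principal_open ?E"
    by (rule principal_openI[OF _ _ refl, where v\<^sub>0 = "(c - 1, 1, 1, 0)"])
       (auto intro!: poly_fun_intros)
  show "regular_map ?D (\<lambda>t. r6 \<alpha> \<eta>)"
    unfolding regular_map_def r6_def split_def r_dom_eq Let_def fst_conv snd_conv
    by (intro conjI regular_intros) (auto simp: add_eq_0_iff)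
  show "regular_map ?E (\<lambda>t. ?G)"
    unfolding regular_map_def r1_def r5_def r3_inv_def split_def fst_conv snd_conv
    by (intro conjI regular_intros) auto
  show "canonical_at (\<lambda>t. r6 \<alpha> \<eta>) (\<lambda>v. 0) t v" if "v \<in> ?D" for t v
    using that by (intro canonical_at_autonomous r6_canonical)
  show "r6 \<alpha> \<eta> v \<in> ?E" and "?G (r6 \<alpha> \<eta> v) = v" if "v \<in> ?D" for v
  proof -
    obtain q1 p1 q2 p2 where v: "v = (q1, p1, q2, p2)"
      by (rule prod_cases4)
    have nz: "q1 \<noteq> 0" "q2 \<noteq> 0" "q1 * p1 + \<alpha> 1 \<noteq> 0"
      using that unfolding r_dom_eq v by auto
    then have "fst v \<noteq> 0" "fst (snd (snd (r1 \<alpha> v))) \<noteq> 0" "fst (snd (r5 \<alpha> (r1 \<alpha> v))) \<noteq> 0"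
      by (auto simp: v r1_def r5_def add_eq_0_iff)
    then show "?G (r6 \<alpha> \<eta> v) = v"
      unfolding r6_eq c_def[symmetric] by (simp add: r3_inv r5_involution r1_involution)
    define Y W where "Y = - (q1 * p1 + \<alpha> 1) * q1" and "W = - (q2 * p2 + \<alpha> 5) * q2"
    have Y: "Y \<noteq> 0"
      using nz by (auto simp: Y_def add_eq_0_iff)
    obtain x y z w where u: "r6 \<alpha> \<eta> v = (x, y, z, w)"
      by (rule prod_cases4)
    have xyzw: "x = - (1 / q1 * Y + 1 / q2 * W - c) * Y" "y = 1 / Y" "z = 1 / q2 * Y" "w = W / Y"
      using u unfolding v r6_def c_def Let_def prod.case Y_def W_def by simp_all
    then have "x * y = - (1 / q1 * Y + 1 / q2 * W - c)" "z * w = 1 / q2 * W"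
      using Y by simp_all
    then have "c - x * y - z * w = 1 / q1 * Y"
      by simp
    with xyzw show "r6 \<alpha> \<eta> v \<in> ?E"
      using Y nz unfolding u by simp
  qed
  show "?G u \<in> ?D" and "r6 \<alpha> \<eta> (?G u) = u" if "u \<in> ?E" for u
  proof -
    obtain x y z w where u: "u = (x, y, z, w)"
      by (rule prod_cases4)
    have nz: "y \<noteq> 0" "z \<noteq> 0" "c - x * y - z * w \<noteq> 0"
      using that unfolding u by auto
    define X where "X = (c - x * y - z * w) * y"
    have X: "X \<noteq> 0"
      using nz by (simp add: X_def)
    have G: "?G u = (1 / X, - (X * (1 / y) + \<alpha> 1) * X, 1 / (z * y),
        - (z * y * (w / y) + \<alpha> 5) * (z * y))"
      by (simp add: u r1_def r5_def r3_inv_def X_def)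
    show "?G u \<in> ?D"
      using X nz unfolding G r_dom_eq by (simp add: field_simps)
    have "fst (snd u) \<noteq> 0" "fst (snd (snd (r3_inv (\<lambda>_. c) 0 u))) \<noteq> 0"
      "fst (r5 \<alpha> (r3_inv (\<lambda>_. c) 0 u)) \<noteq> 0"
      using nz by (auto simp: u r3_inv_def r5_def)
    then show "r6 \<alpha> \<eta> (?G u) = u"
      unfolding r6_eq c_def[symmetric] by (simp add: r3_inv r5_involution r1_involution)
  qed
  show "K6 \<alpha> \<eta> t (r6 \<alpha> \<eta> v) = H_FS \<alpha> \<eta> t v - 0" if "v \<in> ?D" for t v
    using that K6_r6[OF assms] unfolding r_dom_eq
    by (cases v rule: prod_cases4) simp
qed (rule H_FS_regular K_regular K_polynomial)+

theorem mainTheorem1: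
  fixes \<alpha> :: "nat \<Rightarrow> complex" and \<eta> :: complex
  assumes "\<alpha> 0 + \<alpha> 1 + \<alpha> 2 + \<alpha> 3 + \<alpha> 4 + \<alpha> 5 = 1"
  shows "\<forall>i\<in>{0..6}.
    (\<forall>t. t \<noteq> 0 \<longrightarrow> t \<noteq> 1 \<longrightarrow>
       birational_on (r_dom \<alpha> i) (r_map \<alpha> \<eta> i t) \<and>
       symplectic_on (r_dom \<alpha> i) (r_map \<alpha> \<eta> i t)) \<and>
    (\<exists>K. polynomial_hamiltonian K \<and>
       transforms_system (r_dom \<alpha> i) (r_map \<alpha> \<eta> i) (H_FS \<alpha> \<eta>) K \<and>
       (\<forall>t. t \<noteq> 0 \<longrightarrow> t \<noteq> 1 \<longrightarrow> (\<forall>(q1, p1, q2, p2) \<in> r_dom \<alpha> i.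
          K t (r_map \<alpha> \<eta> i t (q1, p1, q2, p2)) =
          H_FS \<alpha> \<eta> t (q1, p1, q2, p2) - (if i = 2 then p1 else 0))))"
proof
  fix i :: nat assume "i \<in> {0..6}"
  then have i: "i \<in> {0, 1, 2, 3, 4, 5, 6}"
    by auto
  have r: "r_map \<alpha> \<eta> 0 = (\<lambda>t. r0 \<alpha>)" "r_map \<alpha> \<eta> 1 = (\<lambda>t. r1 \<alpha>)"
    "r_map \<alpha> \<eta> 2 = r2 \<alpha>" "r_map \<alpha> \<eta> 3 = (\<lambda>t. r3 \<alpha> \<eta>)"
    "r_map \<alpha> \<eta> 4 = (\<lambda>t. r4 \<alpha>)" "r_map \<alpha> \<eta> 5 = (\<lambda>t. r5 \<alpha>)"
    "r_map \<alpha> \<eta> 6 = (\<lambda>t. r6 \<alpha> \<eta>)"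
    by (simp_all add: r_map_def fun_eq_iff eval_nat_numeral)
  have "polynomial_hamiltonian_in (r_dom \<alpha> i) (r_map \<alpha> \<eta> i) (H_FS \<alpha> \<eta>)
      (\<lambda>v. if i = 2 then fst (snd v) else 0)"
    using i chart_r0[OF assms] chart_r1[OF assms] chart_r2[OF assms] chart_r3[OF assms]
      chart_r4[OF assms] chart_r5[OF assms] chart_r6[OF assms]
    by (elim insertE emptyE) (simp_all only: r, simp_all)
  then show "(\<forall>t. t \<noteq> 0 \<longrightarrow> t \<noteq> 1 \<longrightarrow>
       birational_on (r_dom \<alpha> i) (r_map \<alpha> \<eta> i t) \<and>
       symplectic_on (r_dom \<alpha> i) (r_map \<alpha> \<eta> i t)) \<and>
    (\<exists>K. polynomial_hamiltonian K \<and>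
       transforms_system (r_dom \<alpha> i) (r_map \<alpha> \<eta> i) (H_FS \<alpha> \<eta>) K \<and>
       (\<forall>t. t \<noteq> 0 \<longrightarrow> t \<noteq> 1 \<longrightarrow> (\<forall>(q1, p1, q2, p2) \<in> r_dom \<alpha> i.
          K t (r_map \<alpha> \<eta> i t (q1, p1, q2, p2)) =
          H_FS \<alpha> \<eta> t (q1, p1, q2, p2) - (if i = 2 then p1 else 0))))"
    unfolding polynomial_hamiltonian_in_def split_def by simp
qed

end
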